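(* Let $h>a>0$ and $2L\in(a^2,2ah-a^2)$. Consider the problem $$\min\{\mathcal F(\gamma):\ \gamma\in\mathcal A_{a,h,L}\}.\qquad (P)$$ Then $\gamma\in\mathcal A_{a,h,L}$ is a solution to problem (P) if and only if $\gamma_2'(t)\ge0$ for a.e. $t\in(0,1)$ and $\gamma_1'(t)=\gamma_2'(t)$ for a.e. $t$ in $\{\gamma_1'(t)>0\}$. The piecewise affine curve $\gamma^\circ$ connecting the points $(0,0)$, $(0,p)$, $(a,p+a)$ and $(a,h)$, where $p:=\frac La-\frac a2$, is a solution to problem (P). Moreover, $\gamma^\circ$ is the unique solution to problem (P) among all curves $\gamma$ that further satisfy $\{\gamma_1'(t)>0\}=(t_1,t_2)$ (up to a Lebesgue-negligible set) for some $0<t_1<t_2<1$.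
   Context: For $z\in\mathbb R$, $z_+:=\max\{z,0\}$. For an absolutely continuous curve $\gamma=(\gamma_1,\gamma_2):[0,1]\to\mathbb R^2$ with $|\gamma'(t)|\ne0$ for a.e. $t\in(0,1)$, set $$\mathcal F(\gamma)=\int_0^1\frac{(\gamma_2'(t))_+^3}{(\gamma_1'(t))^2+(\gamma_2'(t))^2}\,dt .$$ For $a>0,h>0,L\in(0,ah)$, $\mathcal A_{a,h,L}$ is the set of $\gamma\in AC([0,1];[0,a]\times[0,h])$ such that $\gamma(0)=(0,0)$, $\gamma(1)=(a,h)$, $\gamma$ is simple, $|\gamma'(t)|\neq0$ for a.e. $t\in(0,1)$, $\gamma_1'(t)\ge0$ for a.e. $t\in(0,1)$, and $\int_0^1\gamma_1(t)\gamma_2'(t)\,dt=ah-L$. Curves are identified up to orientation-preserving reparametrization: $\tilde\gamma\sim\gamma$ if $\tilde\gamma=\gamma\circ\phi$ for some monotone nondecreasing map $\phi$ from $[0,1]$ onto itself (representatives are absolutely continuous with $|\gamma'|\neq0$ a.e.); uniqueness is meant with respect to this identification. *)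

theory Defs
  imports "HOL-Analysis.Analysis"
begin

text \<open>
  Curves are functions on all of \<open>real\<close>; only their values on \<open>{0..1}\<close> matter. Derivatives are
  always evaluated at interior points, up to Lebesgue null sets. An absolutely continuous curve is
  differentiable almost everywhere, so the arbitrary value of \<^const>\<open>vector_derivative\<close> at points of
  non-differentiability is irrelevant.
\<close>

definition abs_continuous_on :: "real set \<Rightarrow> (real \<Rightarrow> 'a::metric_space) \<Rightarrow> bool" where
  "abs_continuous_on S f \<longleftrightarrow>
    (\<forall>\<epsilon>>0. \<exists>\<delta>>0. \<forall>(n::nat) u v.
       (\<forall>i<n. u i \<le> v i \<and> {u i..v i} \<subseteq> S) \<longrightarrow>
       disjoint_family_on (\<lambda>i. {u i<..<v i}) {..<n} \<longrightarrow>
       (\<Sum>i<n. v i - u i) < \<delta> \<longrightarrow>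
       (\<Sum>i<n. dist (f (u i)) (f (v i))) < \<epsilon>)"

abbreviation D1 :: "(real \<Rightarrow> real \<times> real) \<Rightarrow> real \<Rightarrow> real" where
  "D1 \<gamma> t \<equiv> fst (vector_derivative \<gamma> (at t))"

abbreviation D2 :: "(real \<Rightarrow> real \<times> real) \<Rightarrow> real \<Rightarrow> real" where
  "D2 \<gamma> t \<equiv> snd (vector_derivative \<gamma> (at t))"

text \<open>
  For absolutely continuous curves the integrand below is bounded by the norm of the derivative,
  hence integrable; the default value of the Bochner integral never comes into play.
\<close>

definition resistance :: "(real \<Rightarrow> real \<times> real) \<Rightarrow> real" where
  "resistance \<gamma> = (LINT t:{0<..<1}|lebesgue. (max (D2 \<gamma> t) 0) ^ 3 / ((D1 \<gamma> t)\<^sup>2 + (D2 \<gamma> t)\<^sup>2))"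

definition admissible :: "real \<Rightarrow> real \<Rightarrow> real \<Rightarrow> (real \<Rightarrow> real \<times> real) set" where
  "admissible a h L =
    {\<gamma>. abs_continuous_on {0..1} \<gamma> \<and>
         \<gamma> ` {0..1} \<subseteq> {0..a} \<times> {0..h} \<and>
         \<gamma> 0 = (0, 0) \<and> \<gamma> 1 = (a, h) \<and>
         simple_path \<gamma> \<and>
         (AE t\<in>{0<..<1} in lebesgue. norm (vector_derivative \<gamma> (at t)) \<noteq> 0) \<and>
         (AE t\<in>{0<..<1} in lebesgue. D1 \<gamma> t \<ge> 0) \<and>
         (LINT t:{0<..<1}|lebesgue. fst (\<gamma> t) * D2 \<gamma> t) = a * h - L}"

definition solution :: "real \<Rightarrow> real \<Rightarrow> real \<Rightarrow> (real \<Rightarrow> real \<times> real) \<Rightarrow> bool" where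
  "solution a h L \<gamma> \<longleftrightarrow>
    \<gamma> \<in> admissible a h L \<and> (\<forall>\<eta>\<in>admissible a h L. resistance \<gamma> \<le> resistance \<eta>)"

definition reparametrization :: "(real \<Rightarrow> real \<times> real) \<Rightarrow> (real \<Rightarrow> real \<times> real) \<Rightarrow> bool" where
  "reparametrization \<eta> \<gamma> \<longleftrightarrow>
    (\<exists>\<phi>. mono_on {0..1} \<phi> \<and> \<phi> ` {0..1} = {0..1} \<and> (\<forall>t\<in>{0..1}. \<eta> t = \<gamma> (\<phi> t)))"

definition interval_support :: "(real \<Rightarrow> real \<times> real) \<Rightarrow> bool" where
  "interval_support \<gamma> \<longleftrightarrow>
    (\<exists>t1 t2. 0 < t1 \<and> t1 < t2 \<and> t2 < 1 \<and>
       (AE t\<in>{0<..<1} in lebesgue. D1 \<gamma> t > 0 \<longleftrightarrow> t \<in> {t1<..<t2}))"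

definition opt_curve :: "real \<Rightarrow> real \<Rightarrow> real \<Rightarrow> real \<Rightarrow> real \<times> real" where
  "opt_curve a h L =
    (let p = L / a - a / 2
     in linepath (0, 0) (0, p) +++ linepath (0, p) (a, p + a) +++ linepath (a, p + a) (a, h))"

end

theory Submission
  imports Defs
begin

text \<open>
  For \<open>x \<ge> 0\<close> one has \<open>(max y 0)\<^sup>3 / (x\<^sup>2 + y\<^sup>2) \<ge> y - x / 2\<close>, with equality iff \<open>y \<ge> 0\<close> and
  \<open>x \<in> {0, y}\<close>. Integrating along an admissible curve bounds the resistance below by \<open>h - a / 2\<close>,
  which depends on the endpoints only, and the equality case is the stated condition. A curve satisfying
  it whose first component moves on a single interval is vertical, then diagonal, then vertical,
  and the area constraint fixes the height of the diagonal part.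

  Integrating the lower bound needs the fundamental theorem of calculus for absolutely continuous
  functions. Differentiability almost everywhere comes from the Vitali covering theorem, and the
  integral is evaluated as a gauge integral.
\<close>

subsection \<open>Absolute continuity and divisions\<close>

text \<open>The linear bound is a tangent construction. Where \<open>y > 0\<close> the integrand is
  positively homogeneous of degree one: it is \<open>y\<close> times \<open>1 / (1 + s^2)\<close>
  with \<open>s = x / y\<close>. This function of \<open>s \<ge> 0\<close> is not convex; the line
  \<open>1 - s / 2\<close> meets it at \<open>s = 0\<close> and is tangent to it at
  \<open>s = 1\<close>. The two contact points are the vertical and the diagonal direction, and
  mixing them costs nothing extra. So the bound alone singles out no curve; the area constraint
  enters only in attainment and in uniqueness. For differentiability, difference quotients are taken
  over intervals \<open>[u, v]\<close> with \<open>u < x < v\<close>. This makes the exceptional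
  sets Borel and turns every bad point into a point of a Vitali cover. Absolute continuity is used
  directly in the covering argument, without a decomposition into monotone functions.\<close>

lemma division_of_real_interval:
  fixes K :: "real set"
  assumes "\<D> division_of S" "K \<in> \<D>"
  shows "Inf K \<le> Sup K" "K = {Inf K..Sup K}" "{Inf K..Sup K} \<subseteq> S"
    "interior K = {Inf K<..<Sup K}" "measure lebesgue K = Sup K - Inf K"
proof -
  obtain c d where K: "K = {c..d}" and "K \<noteq> {}" and "K \<subseteq> S"
    using division_ofD(2-4)[OF assms(1) assms(2)] by auto
  then show "Inf K \<le> Sup K" "K = {Inf K..Sup K}" "{Inf K..Sup K} \<subseteq> S"
    "interior K = {Inf K<..<Sup K}" "measure lebesgue K = Sup K - Inf K"
    by auto
qed

text \<open>Two members of a division meet in a convex set with empty interior, hence in a null set.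
  This lets the smallness condition of absolute continuity be stated through the measure of the
  union.\<close>

lemma measure_division:
  fixes S :: "real set"
  assumes "\<D> division_of S"
  shows "measure lebesgue S = (\<Sum>K\<in>\<D>. Sup K - Inf K)" "S \<in> lmeasurable"
proof -
  note d = division_ofD[OF assms]
  have lm: "K \<in> lmeasurable" if "K \<in> \<D>" for K
    using d(4)[OF that] by auto
  show "S \<in> lmeasurable"
    using lm d(1,6) by (metis fmeasurable.finite_Union subsetI)
  have "pairwise (\<lambda>K J. negligible (K \<inter> J)) \<D>"
  proof (rule pairwiseI)
    fix K J assume "K \<in> \<D>" "J \<in> \<D>" "K \<noteq> J"
    then have "interior (K \<inter> J) = {}" "convex (K \<inter> J)"
      using d(5)[of K J] d(4)[of K] d(4)[of J] by (auto intro!: convex_Int)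
    then show "negligible (K \<inter> J)"
      using negligible_convex_interior by blast
  qed
  then have "measure lebesgue (\<Union>\<D>) = sum (measure lebesgue) \<D>"
    using measure_negligible_finite_Union[OF d(1) lm] by blast
  then show "measure lebesgue S = (\<Sum>K\<in>\<D>. Sup K - Inf K)"
    using d(6) division_of_real_interval(5)[OF assms] by simp
qed

text \<open>The indexed families of the definition are replaced by divisions, the form in which both
  the covering argument and the gauge integral deliver their intervals.\<close>

lemma abs_continuous_on_division:
  fixes f :: "real \<Rightarrow> 'a::metric_space"
  assumes "abs_continuous_on T f" "\<epsilon> > 0"
  obtains \<delta> where "\<delta> > 0"
    "\<And>\<D> S. \<lbrakk>\<D> division_of S; S \<subseteq> T; measure lebesgue S < \<delta>\<rbrakk>
      \<Longrightarrow> (\<Sum>K\<in>\<D>. dist (f (Inf K)) (f (Sup K))) < \<epsilon>"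
proof -
  obtain \<delta> where "\<delta> > 0" and \<delta>: "\<And>(n::nat) u v.
       (\<forall>i<n. u i \<le> v i \<and> {u i..v i} \<subseteq> T) \<longrightarrow>
       disjoint_family_on (\<lambda>i. {u i<..<v i}) {..<n} \<longrightarrow>
       (\<Sum>i<n. v i - u i) < \<delta> \<longrightarrow>
       (\<Sum>i<n. dist (f (u i)) (f (v i))) < \<epsilon>"
    using assms unfolding abs_continuous_on_def by meson
  show thesis
  proof
    fix \<D> S assume \<D>: "\<D> division_of S" "S \<subseteq> T" "measure lebesgue S < \<delta>"
    obtain e where e: "bij_betw e {0..<card \<D>} \<D>"
      using ex_bij_betw_nat_finite division_ofD(1)[OF \<D>(1)] by blast
    have e': "bij_betw e {..<card \<D>} \<D>"
      using e by (simp add: lessThan_atLeast0)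
    have mem: "e i \<in> \<D>" if "i < card \<D>" for i
      using e' that by (auto simp: bij_betw_def)
    have "(\<Sum>i<card \<D>. dist (f (Inf (e i))) (f (Sup (e i)))) < \<epsilon>"
    proof (rule \<delta>[rule_format])
      show "disjoint_family_on (\<lambda>i. {Inf (e i)<..<Sup (e i)}) {..<card \<D>}"
        unfolding disjoint_family_on_def
      proof (intro ballI impI)
        fix i j assume ij: "i \<in> {..<card \<D>}" "j \<in> {..<card \<D>}" "i \<noteq> j"
        then have "e i \<noteq> e j"
          using e' by (auto simp: bij_betw_def inj_on_def)
        then show "{Inf (e i)<..<Sup (e i)} \<inter> {Inf (e j)<..<Sup (e j)} = {}"
          using division_ofD(5)[OF \<D>(1), of "e i" "e j"] mem ij
            division_of_real_interval(4)[OF \<D>(1)] by auto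
      qed
      show "(\<Sum>i<card \<D>. Sup (e i) - Inf (e i)) < \<delta>"
        using sum.reindex_bij_betw[OF e', of "\<lambda>K. Sup K - Inf K"] measure_division(1)[OF \<D>(1)] \<D>(3)
        by simp
    qed (use mem division_of_real_interval[OF \<D>(1)] \<D>(2) in \<open>meson order_trans\<close>)+
    then show "(\<Sum>K\<in>\<D>. dist (f (Inf K)) (f (Sup K))) < \<epsilon>"
      using sum.reindex_bij_betw[OF e', of "\<lambda>K. dist (f (Inf K)) (f (Sup K))"] by simp
  qed fact
qed

lemma abs_continuous_on_interval:
  fixes f :: "real \<Rightarrow> 'a::metric_space"
  assumes "abs_continuous_on T f" "\<epsilon> > 0"
  obtains \<delta> where "\<delta> > 0"
    "\<And>u v. \<lbrakk>u \<le> v; {u..v} \<subseteq> T; v - u < \<delta>\<rbrakk> \<Longrightarrow> dist (f u) (f v) < \<epsilon>"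
proof -
  obtain \<delta> where "\<delta> > 0" and \<delta>: "\<And>\<D> S. \<lbrakk>\<D> division_of S; S \<subseteq> T; measure lebesgue S < \<delta>\<rbrakk>
      \<Longrightarrow> (\<Sum>K\<in>\<D>. dist (f (Inf K)) (f (Sup K))) < \<epsilon>"
    using abs_continuous_on_division[OF assms] by blast
  have "dist (f u) (f v) < \<epsilon>" if "u \<le> v" "{u..v} \<subseteq> T" "v - u < \<delta>" for u v
    using \<delta>[of "{{u..v}}" "{u..v}"] that division_of_self[of u v] by simp
  with \<open>\<delta> > 0\<close> show thesis
    using that by blast
qed

lemma abs_continuous_on_imp_continuous_on:
  fixes f :: "real \<Rightarrow> 'a::metric_space"
  assumes "abs_continuous_on {a..b} f"
  shows "continuous_on {a..b} f"
  unfolding continuous_on_iff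
proof (intro ballI allI impI)
  fix x and \<epsilon> :: real assume x: "x \<in> {a..b}" and "\<epsilon> > 0"
  then obtain \<delta> where "\<delta> > 0"
    and \<delta>: "\<And>u v. \<lbrakk>u \<le> v; {u..v} \<subseteq> {a..b}; v - u < \<delta>\<rbrakk> \<Longrightarrow> dist (f u) (f v) < \<epsilon>"
    using abs_continuous_on_interval[OF assms] by blast
  have "dist (f y) (f x) < \<epsilon>" if "y \<in> {a..b}" "dist y x < \<delta>" for y
    using \<delta>[of "min x y" "max x y"] x that
    by (cases "x \<le> y") (auto simp: dist_real_def dist_commute)
  with \<open>\<delta> > 0\<close> show "\<exists>d>0. \<forall>y\<in>{a..b}. dist y x < d \<longrightarrow> dist (f y) (f x) < \<epsilon>"
    by blast
qed

text \<open>One domination principle covers components, negatives, differences of components, half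
  squares and, with the identity as \<open>f\<close>, Lipschitz functions.\<close>

lemma abs_continuous_on_compose:
  fixes f :: "real \<Rightarrow> 'a::metric_space" and g :: "real \<Rightarrow> 'b::metric_space"
  assumes f: "abs_continuous_on T f"
    and le: "\<And>x y. x \<in> T \<Longrightarrow> y \<in> T \<Longrightarrow> dist (g x) (g y) \<le> B * dist (f x) (f y)"
  shows "abs_continuous_on T g"
  unfolding abs_continuous_on_def
proof (intro allI impI)
  fix \<epsilon> :: real assume "\<epsilon> > 0"
  \<comment> \<open>\<open>B\<close> may be zero or negative, while the division of
    \<open>\<epsilon>\<close> needs a positive constant.\<close>
  define B' where "B' = max B 1"
  have "\<epsilon> / B' > 0" "B' > 0"
    using \<open>\<epsilon> > 0\<close> by (auto simp: B'_def)
  obtain \<delta> where "\<delta> > 0" and \<delta>: "\<And>(n::nat) u v.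
       (\<forall>i<n. u i \<le> v i \<and> {u i..v i} \<subseteq> T) \<Longrightarrow>
       disjoint_family_on (\<lambda>i. {u i<..<v i}) {..<n} \<Longrightarrow>
       (\<Sum>i<n. v i - u i) < \<delta> \<Longrightarrow>
       (\<Sum>i<n. dist (f (u i)) (f (v i))) < \<epsilon> / B'"
    using f \<open>\<epsilon> / B' > 0\<close> unfolding abs_continuous_on_def by meson
  have "(\<Sum>i<n. dist (g (u i)) (g (v i))) < \<epsilon>"
    if uv: "\<forall>i<n. u i \<le> v i \<and> {u i..v i} \<subseteq> T"
      and "disjoint_family_on (\<lambda>i. {u i<..<v i}) {..<n}" "(\<Sum>i<n. v i - u i) < \<delta>"
    for n :: nat and u v
  proof -
    have "(\<Sum>i<n. dist (g (u i)) (g (v i))) \<le> (\<Sum>i<n. B' * dist (f (u i)) (f (v i)))"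
    proof (rule sum_mono)
      fix i assume "i \<in> {..<n}"
      then have "u i \<in> T" "v i \<in> T"
        using uv by force+
      then have "dist (g (u i)) (g (v i)) \<le> B * dist (f (u i)) (f (v i))"
        using le by blast
      also have "\<dots> \<le> B' * dist (f (u i)) (f (v i))"
        by (intro mult_right_mono) (auto simp: B'_def)
      finally show "dist (g (u i)) (g (v i)) \<le> B' * dist (f (u i)) (f (v i))" .
    qed
    also have "\<dots> < B' * (\<epsilon> / B')"
      unfolding sum_distrib_left[symmetric] using \<delta>[OF that] \<open>B' > 0\<close>
      by (intro mult_strict_left_mono)
    finally show ?thesis
      using \<open>B' > 0\<close> by simp
  qed
  with \<open>\<delta> > 0\<close> show "\<exists>\<delta>>0. \<forall>(n::nat) u v.
       (\<forall>i<n. u i \<le> v i \<and> {u i..v i} \<subseteq> T) \<longrightarrow>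
       disjoint_family_on (\<lambda>i. {u i<..<v i}) {..<n} \<longrightarrow>
       (\<Sum>i<n. v i - u i) < \<delta> \<longrightarrow>
       (\<Sum>i<n. dist (g (u i)) (g (v i))) < \<epsilon>"
    by blast
qed

lemma abs_continuous_on_subset:
  "abs_continuous_on T f \<Longrightarrow> S \<subseteq> T \<Longrightarrow> abs_continuous_on S f"
  unfolding abs_continuous_on_def by (meson order_trans)

lemma abs_continuous_on_id: "abs_continuous_on T (\<lambda>x. x)"
  unfolding abs_continuous_on_def
proof (intro allI impI)
  fix \<epsilon> :: real assume "\<epsilon> > 0"
  have "(\<Sum>i<n. dist (u i) (v i)) = (\<Sum>i<n. v i - u i)" if "\<forall>i<n. u i \<le> v i \<and> {u i..v i} \<subseteq> T"
    for n :: nat and u v :: "nat \<Rightarrow> real"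
    using that by (intro sum.cong) (auto simp: dist_real_def)
  with \<open>\<epsilon> > 0\<close> show "\<exists>\<delta>>0. \<forall>(n::nat) u v.
       (\<forall>i<n. u i \<le> v i \<and> {u i..v i} \<subseteq> T) \<longrightarrow>
       disjoint_family_on (\<lambda>i. {u i<..<v i}) {..<n} \<longrightarrow>
       (\<Sum>i<n. v i - u i) < \<delta> \<longrightarrow> (\<Sum>i<n. dist (u i) (v i)) < \<epsilon>"
    by auto
qed

text \<open>Tagging every interval by its left end makes the telescoping lemma for tagged divisions
  applicable.\<close>

lemma sum_increments_division:
  fixes f :: "real \<Rightarrow> real"
  assumes "\<D> division_of {a..b}" "a \<le> b"
  shows "(\<Sum>K\<in>\<D>. f (Sup K) - f (Inf K)) = f b - f a"
proof -
  note d = division_ofD[OF assms(1)]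
  have "(\<lambda>K. (Inf K, K)) ` \<D> tagged_division_of {a..b}"
  proof (rule tagged_division_ofI)
    fix x K assume "(x, K) \<in> (\<lambda>K. (Inf K, K)) ` \<D>"
    then have "K \<in> \<D>" "x = Inf K"
      by auto
    then show "x \<in> K" "K \<subseteq> {a..b}" "\<exists>c d. K = cbox c d"
      using d(2,4) division_of_real_interval(1,2)[OF assms(1)] by (auto, force)
  next
    have "\<Union>(snd ` (\<lambda>K. (Inf K, K)) ` \<D>) = {a..b}"
      using d(6) by (simp add: image_image)
    then show "\<Union>{K. \<exists>x. (x, K) \<in> (\<lambda>K. (Inf K, K)) ` \<D>} = {a..b}"
      by (auto simp: image_iff)
  qed (use d(1,5) in auto)
  from additive_tagged_division_1[OF assms(2) this, of f] show ?thesis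
    by (simp add: sum.reindex inj_on_def)
qed

text \<open>The difference of the two sums is the sum over the gaps that \<open>\<C>\<close> leaves in \<open>\<D>\<close>.\<close>

lemma abs_continuous_on_refine:
  fixes f :: "real \<Rightarrow> real"
  assumes f: "abs_continuous_on {a..b} f" and "\<epsilon> > 0" and "a \<le> b"
  obtains \<delta> where "\<delta> > 0"
    "\<And>\<C> \<D> S T. \<lbrakk>\<C> division_of S; \<D> division_of T; S \<subseteq> T; T \<subseteq> {a..b};
        measure lebesgue T - measure lebesgue S < \<delta>\<rbrakk>
      \<Longrightarrow> \<bar>(\<Sum>K\<in>\<D>. f (Sup K) - f (Inf K)) - (\<Sum>K\<in>\<C>. f (Sup K) - f (Inf K))\<bar> < \<epsilon>"
proof -
  obtain \<delta> where "\<delta> > 0" and \<delta>: "\<And>\<D> S. \<lbrakk>\<D> division_of S; S \<subseteq> {a..b}; measure lebesgue S < \<delta>\<rbrakk>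
      \<Longrightarrow> (\<Sum>K\<in>\<D>. dist (f (Inf K)) (f (Sup K))) < \<epsilon>"
    using abs_continuous_on_division[OF f \<open>\<epsilon> > 0\<close>] by blast
  show thesis
  proof
    fix \<C> \<D> :: "real set set" and S T
    assume \<C>: "\<C> division_of S" and \<D>: "\<D> division_of T" and "S \<subseteq> T" and T: "T \<subseteq> {a..b}"
      and small: "measure lebesgue T - measure lebesgue S < \<delta>"
    obtain r where r: "\<C> \<subseteq> r" "r division_of T"
      using partial_division_extend[OF \<C> \<D> \<open>S \<subseteq> T\<close>] by blast
    have "\<D> division_of \<Union>\<D>" "\<Union>\<D> \<subseteq> cbox a b"
      using \<D> division_ofD(6)[OF \<D>] T by auto
    then obtain q where q: "\<D> \<subseteq> q" "q division_of {a..b}"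
      using partial_division_extend_interval by (metis box_real(2))
    \<comment> \<open>\<open>e\<close> fills what \<open>\<D>\<close> leaves free in
      \<open>{a..b}\<close>, so that both \<open>\<D>\<close> and its refinement \<open>r\<close>
      can be completed by the same intervals.\<close>
    define e where "e = q - \<D>"
    have e: "e division_of \<Union>e"
      using division_of_subset[of q "q - \<D>"] q(2) division_ofD(6)[OF q(2)] unfolding e_def by auto
    have disj: "interior (\<Union>\<D>) \<inter> interior (\<Union>e) = {}"
    proof (rule Int_interior_Union_intervals)
      fix J assume J: "J \<in> e"
      have "interior J \<inter> interior (\<Union>\<D>) = {}"
      proof (rule Int_interior_Union_intervals)
        fix K assume "K \<in> \<D>"
        then show "interior J \<inter> interior K = {}"
          using J q division_ofD(5)[OF q(2), of J K] unfolding e_def by auto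
      qed (use division_ofD[OF \<D>] in auto)
      then show "interior (\<Union>\<D>) \<inter> interior J = {}"
        by auto
    qed (use division_ofD[OF e] in auto)
    \<comment> \<open>Completed by \<open>e\<close>, both sums telescope to
      \<open>g b - g a\<close>.\<close>
    have sum_eq: "(\<Sum>K\<in>r. g (Sup K) - g (Inf K)) = (\<Sum>K\<in>\<D>. g (Sup K) - g (Inf K))"
      for g :: "real \<Rightarrow> real"
    proof -
      have "T \<union> \<Union>e = {a..b}"
        using division_ofD(6)[OF q(2)] division_ofD(6)[OF \<D>] Union_Un_distrib[of \<D> "q - \<D>"]
          Diff_partition[OF q(1)] T unfolding e_def by (simp add: Un_absorb1)
      moreover have "interior T \<inter> interior (\<Union>e) = {}"
        using disj division_ofD(6)[OF \<D>] by simp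
      ultimately have re: "(r \<union> e) division_of {a..b}"
        using division_disjoint_union[OF r(2) e] by simp
      \<comment> \<open>\<open>r\<close> and \<open>e\<close> may still share members; these are
        single points and contribute nothing.\<close>
      have "(\<Sum>K\<in>r \<inter> e. g (Sup K) - g (Inf K)) = 0"
      proof (intro sum.neutral ballI)
        fix K assume K: "K \<in> r \<inter> e"
        then have "interior K \<subseteq> interior T" "interior K \<subseteq> interior (\<Union>e)"
          using division_ofD(2)[OF r(2), of K] by (simp_all add: interior_mono Sup_upper)
        then have "{Inf K<..<Sup K} = {}"
          using division_of_real_interval(4)[OF r(2), of K] K \<open>interior T \<inter> interior (\<Union>e) = {}\<close>
          by blast
        then have "Inf K = Sup K"
          using division_of_real_interval(1)[OF r(2), of K] K by simp
        then show "g (Sup K) - g (Inf K) = 0"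
          by simp
      qed
      then have "(\<Sum>K\<in>r \<union> e. g (Sup K) - g (Inf K))
          = (\<Sum>K\<in>r. g (Sup K) - g (Inf K)) + (\<Sum>K\<in>e. g (Sup K) - g (Inf K))"
        using sum.union_inter[of r e "\<lambda>K. g (Sup K) - g (Inf K)"] division_ofD(1)[OF r(2)]
          division_ofD(1)[OF e] by simp
      moreover have "(\<Sum>K\<in>q. g (Sup K) - g (Inf K))
          = (\<Sum>K\<in>\<D>. g (Sup K) - g (Inf K)) + (\<Sum>K\<in>e. g (Sup K) - g (Inf K))"
        using sum.subset_diff[OF q(1) division_ofD(1)[OF q(2)], of "\<lambda>K. g (Sup K) - g (Inf K)"]
        unfolding e_def by simp
      ultimately show ?thesis
        using sum_increments_division[OF re \<open>a \<le> b\<close>, of g] sum_increments_division[OF q(2) \<open>a \<le> b\<close>, of g]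
        by simp
    qed
    have split: "(\<Sum>K\<in>r. g (Sup K) - g (Inf K))
        = (\<Sum>K\<in>r - \<C>. g (Sup K) - g (Inf K)) + (\<Sum>K\<in>\<C>. g (Sup K) - g (Inf K))" for g :: "real \<Rightarrow> real"
      using sum.subset_diff[OF r(1) division_ofD(1)[OF r(2)], of "\<lambda>K. g (Sup K) - g (Inf K)"] .
    have gap: "(r - \<C>) division_of \<Union>(r - \<C>)"
      using division_of_subset[of r "r - \<C>"] r(2) division_ofD(6)[OF r(2)] by auto
    \<comment> \<open>For the identity function the increments are lengths, so the same two
      identities compute the measure of the gaps.\<close>
    have "measure lebesgue (\<Union>(r - \<C>)) < \<delta>"
      using measure_division(1)[OF gap] measure_division(1)[OF \<C>] measure_division(1)[OF \<D>]
        sum_eq[of "\<lambda>x. x"] split[of "\<lambda>x. x"] small by simp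
    moreover have "\<Union>(r - \<C>) \<subseteq> {a..b}"
      using division_ofD(6)[OF r(2)] T by auto
    ultimately have "(\<Sum>K\<in>r - \<C>. dist (f (Inf K)) (f (Sup K))) < \<epsilon>"
      using \<delta>[OF gap] by blast
    moreover have "\<bar>\<Sum>K\<in>r - \<C>. f (Sup K) - f (Inf K)\<bar> \<le> (\<Sum>K\<in>r - \<C>. dist (f (Inf K)) (f (Sup K)))"
      using sum_abs[of "\<lambda>K. f (Sup K) - f (Inf K)" "r - \<C>"]
      by (simp add: dist_real_def abs_minus_commute)
    ultimately show "\<bar>(\<Sum>K\<in>\<D>. f (Sup K) - f (Inf K)) - (\<Sum>K\<in>\<C>. f (Sup K) - f (Inf K))\<bar> < \<epsilon>"
      using sum_eq[of f] split[of f] by simp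
  qed fact
qed

subsection \<open>Differentiability almost everywhere\<close>

text \<open>The intervals satisfying \<open>P\<close> inside \<open>U\<close> form a Vitali cover of
  \<open>E\<close>. A countable disjoint subfamily covers almost all of \<open>E\<close>, and by
  continuity of the measure from below a finite part of it already covers all but
  \<open>\<epsilon>\<close>.\<close>

lemma Vitali_division:
  fixes E U :: "real set" and P :: "real \<Rightarrow> real \<Rightarrow> bool"
  assumes E: "E \<in> lmeasurable" and U: "open U" "E \<subseteq> U" and "\<epsilon> > 0"
    and P: "\<And>x d. \<lbrakk>x \<in> E; d > 0\<rbrakk> \<Longrightarrow> \<exists>u v. u < x \<and> x < v \<and> v - u < d \<and> P u v"
  obtains \<D> S where "\<D> division_of S" "S \<subseteq> U" "measure lebesgue E - \<epsilon> < measure lebesgue S"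
    "\<forall>K\<in>\<D>. Inf K < Sup K \<and> P (Inf K) (Sup K)"
proof -
  define I where "I = {(u, v). u < v \<and> P u v \<and> {u..v} \<subseteq> U}"
  \<comment> \<open>An interval is the closed ball around its midpoint, the shape that the covering
    theorem asks for; the covered point need not be the center.\<close>
  define c where "c i = (fst i + snd i) / 2" for i :: "real \<times> real"
  define \<rho> where "\<rho> i = (snd i - fst i) / 2" for i :: "real \<times> real"
  have cball: "cball (c i) (\<rho> i) = {fst i..snd i}" for i
    unfolding c_def \<rho>_def cball_eq_atLeastAtMost by (simp add: field_simps)
  have "\<exists>i. i \<in> I \<and> x \<in> cball (c i) (\<rho> i) \<and> \<rho> i < d" if "x \<in> E" "0 < d" for x d
  proof -
    obtain e where "e > 0" and e: "ball x e \<subseteq> U"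
      using U \<open>x \<in> E\<close> by (meson openE subsetD)
    then obtain u v where uv: "u < x" "x < v" "v - u < min d e" "P u v"
      using P[OF \<open>x \<in> E\<close>, of "min d e"] \<open>0 < d\<close> by auto
    then have "{u..v} \<subseteq> ball x e"
      by (auto simp: dist_real_def)
    with e uv have "(u, v) \<in> I"
      unfolding I_def by auto
    moreover have "\<rho> (u, v) < d"
      using uv unfolding \<rho>_def by simp
    ultimately show ?thesis
      using uv cball[of "(u, v)"] by (intro exI[of _ "(u, v)"]) auto
  qed
  note covered = this
  obtain C where C: "countable C" "C \<subseteq> I"
      "pairwise (\<lambda>i j. disjnt (cball (c i) (\<rho> i)) (cball (c j) (\<rho> j))) C"
      "negligible (E - (\<Union>i\<in>C. cball (c i) (\<rho> i)))"
  proof (rule Vitali_covering_theorem_cballs[of I \<rho> E c])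
    show "0 < \<rho> i" if "i \<in> I" for i
      using that unfolding I_def \<rho>_def by auto
  qed (use covered in auto)
  obtain F where F: "finite F" "F \<subseteq> C"
    "measure lebesgue E - \<epsilon> < measure lebesgue (E \<inter> (\<Union>i\<in>F. {fst i..snd i}))"
  proof (cases "C = {}")
    case True
    then have "measure lebesgue E = 0"
      using C(4) by (simp add: negligible_imp_measure0)
    with that[of "{}"] \<open>\<epsilon> > 0\<close> show thesis
      by simp
  next
    case False
    \<comment> \<open>The finite stages of an enumeration of \<open>C\<close>, which has to be
      nonempty for \<open>from_nat_into\<close> to stay inside it.\<close>
    define A where "A n = E \<inter> (\<Union>i\<in>from_nat_into C ` {..n}. {fst i..snd i})" for n :: nat
    have "range A \<subseteq> sets lebesgue"
      using E unfolding A_def by (auto intro!: sets.Int sets.finite_UN)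
    have UA: "(\<Union>n. A n) = E \<inter> (\<Union>i\<in>C. {fst i..snd i})"
    proof -
      have "(\<Union>n. from_nat_into C ` {..n}) = C"
      proof
        show "C \<subseteq> (\<Union>n. from_nat_into C ` {..n})"
        proof
          fix i assume "i \<in> C"
          then obtain n where "i = from_nat_into C n"
            using from_nat_into_surj[OF C(1)] by metis
          then show "i \<in> (\<Union>n. from_nat_into C ` {..n})"
            by blast
        qed
        show "(\<Union>n. from_nat_into C ` {..n}) \<subseteq> C"
          using from_nat_into[OF False] by blast
      qed
      then have "(\<Union>i\<in>C. {fst i..snd i}) = (\<Union>n. \<Union>i\<in>from_nat_into C ` {..n}. {fst i..snd i})"
        by (metis UN_UN_flatten)
      then show ?thesis
        unfolding A_def by (simp only: Int_UN_distrib)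
    qed
    have "emeasure lebesgue (\<Union>n. A n) \<noteq> \<infinity>"
      using E UA emeasure_mono[of "\<Union>n. A n" E lebesgue] by (auto simp: fmeasurable_def top_unique less_top)
    moreover have "incseq A"
      unfolding A_def incseq_def by force
    ultimately have "(\<lambda>n. measure lebesgue (A n)) \<longlonglongrightarrow> measure lebesgue (\<Union>n. A n)"
      using Lim_measure_incseq \<open>range A \<subseteq> sets lebesgue\<close> by blast
    moreover have "measure lebesgue (\<Union>n. A n) = measure lebesgue E"
    proof -
      have "negligible ((E - (\<Union>n. A n)) \<union> ((\<Union>n. A n) - E))"
        using C(4) unfolding UA cball by (auto simp: Diff_Int)
      then show ?thesis
        by (metis E measure_negligible_symdiff)
    qed
    ultimately have "eventually (\<lambda>n. measure lebesgue E - \<epsilon> < measure lebesgue (A n)) sequentially"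
      using \<open>\<epsilon> > 0\<close> by (simp add: order_tendstoD(1))
    then obtain n where "measure lebesgue E - \<epsilon> < measure lebesgue (A n)"
      by (meson eventually_sequentially order_refl)
    then show thesis
      using that[of "from_nat_into C ` {..n}"] from_nat_into[OF False] unfolding A_def by blast
  qed
  define S where "S = (\<Union>i\<in>F. {fst i..snd i})"
  have lt: "fst i < snd i" "P (fst i) (snd i)" "{fst i..snd i} \<subseteq> U" if "i \<in> F" for i
  proof -
    have "i \<in> I"
      using that F(2) C(2) by blast
    then show "fst i < snd i" "P (fst i) (snd i)" "{fst i..snd i} \<subseteq> U"
      unfolding I_def by (simp_all add: case_prod_beta)
  qed
  show thesis
  proof
    show div: "(\<lambda>i. {fst i..snd i}) ` F division_of S"
    proof (rule division_ofI)
      fix K1 K2 assume "K1 \<in> (\<lambda>i. {fst i..snd i}) ` F" "K2 \<in> (\<lambda>i. {fst i..snd i}) ` F" "K1 \<noteq> K2"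
      then obtain i j where "i \<in> F" "j \<in> F" "i \<noteq> j" "K1 = {fst i..snd i}" "K2 = {fst j..snd j}"
        by auto
      then have "disjnt (cball (c i) (\<rho> i)) (cball (c j) (\<rho> j))"
        using pairwiseD[OF C(3), of i j] F(2) by (meson subsetD)
      then have "K1 \<inter> K2 = {}"
        using \<open>K1 = _\<close> \<open>K2 = _\<close> cball unfolding disjnt_def by simp
      then show "interior K1 \<inter> interior K2 = {}"
        using interior_subset[of K1] interior_subset[of K2] by (meson disjoint_iff subsetD)
    qed (use F(1) lt in \<open>auto simp: S_def less_imp_le\<close>)
    show "S \<subseteq> U"
      using lt(3) unfolding S_def by blast
    show "measure lebesgue E - \<epsilon> < measure lebesgue S"
      using F(3) measure_mono_fmeasurable[of "E \<inter> S" S lebesgue] measure_division(2)[OF div] E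
      unfolding S_def[symmetric] by (auto simp: fmeasurable_def)
    show "\<forall>K\<in>(\<lambda>i. {fst i..snd i}) ` F. Inf K < Sup K \<and> P (Inf K) (Sup K)"
      using lt by (auto simp: less_imp_le)
  qed
qed

text \<open>Arbitrarily short intervals straddling \<open>x\<close> have mean slope above
  \<open>q\<close>; for \<open>- f\<close> and \<open>- p\<close> this means mean slopes below
  \<open>p\<close>. As both ends differ from \<open>x\<close>, a witnessing interval also serves all
  points near \<open>x\<close>.\<close>

definition steep :: "(real \<Rightarrow> real) \<Rightarrow> real \<Rightarrow> real set \<Rightarrow> real set" where
  "steep f q T = {x. \<forall>d>0. \<exists>u v. u < x \<and> x < v \<and> v - u < d \<and> {u..v} \<subseteq> T \<and> f v - f u > q * (v - u)}"

text \<open>For a fixed bound on the length, the points straddled by a witness form a union of open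
  intervals. Letting the bound run through \<open>1 / (n + 1)\<close> gives a countable intersection
  of open sets.\<close>

lemma steep_sets: "steep f q T \<in> sets lebesgue"
proof -
  define G where "G n = \<Union>{{u<..<v} |u v. v - u < inverse (real (Suc n)) \<and> {u..v} \<subseteq> T \<and> f v - f u > q * (v - u)}"
    for n :: nat
  have "steep f q T = (\<Inter>n. G n)"
  proof (intro set_eqI iffI)
    fix x assume "x \<in> steep f q T"
    then show "x \<in> (\<Inter>n. G n)"
      unfolding steep_def G_def
    proof (intro INT_I)
      fix n :: nat
      have "inverse (real (Suc n)) > 0"
        by simp
      then obtain u v where "u < x" "x < v" "v - u < inverse (real (Suc n))" "{u..v} \<subseteq> T"
        "f v - f u > q * (v - u)"
        using \<open>x \<in> steep f q T\<close> unfolding steep_def by blast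
      then show "x \<in> \<Union>{{u<..<v} |u v. v - u < inverse (real (Suc n)) \<and> {u..v} \<subseteq> T \<and> f v - f u > q * (v - u)}"
        by (intro UnionI[of "{u<..<v}"] CollectI exI[of _ u] exI[of _ v]) simp_all
    qed
  next
    fix x assume x: "x \<in> (\<Inter>n. G n)"
    have "\<exists>u v. u < x \<and> x < v \<and> v - u < d \<and> {u..v} \<subseteq> T \<and> f v - f u > q * (v - u)"
      if "d > 0" for d
    proof -
      obtain n where "inverse (real (Suc n)) < d"
        using reals_Archimedean[OF \<open>d > 0\<close>] by metis
      moreover obtain u v where "x \<in> {u<..<v}" "v - u < inverse (real (Suc n))" "{u..v} \<subseteq> T"
          "f v - f u > q * (v - u)"
        using INT_D[OF x, of n] unfolding G_def by blast
      ultimately show ?thesis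
        by (intro exI[of _ u] exI[of _ v]) auto
    qed
    then show "x \<in> steep f q T"
      unfolding steep_def by blast
  qed
  moreover have "open (G n)" for n
    unfolding G_def by (rule open_Union) auto
  ultimately have "steep f q T \<in> sets borel"
    by (simp add: borel_open sets.countable_INT)
  then show ?thesis
    by simp
qed

lemma steep_subset: "steep f q T \<subseteq> T"
proof
  fix x assume "x \<in> steep f q T"
  then obtain u v where "u < x" "x < v" "{u..v} \<subseteq> T"
    unfolding steep_def using zero_less_one by blast
  then show "x \<in> T"
    by force
qed

text \<open>Cover the set by intervals of slope below \<open>p\<close>, then cover it again inside these intervals by
  intervals of slope above \<open>q\<close>. What the second family leaves uncovered in the first one has small
  measure, hence contributes little by absolute continuity.\<close>

lemma negligible_steep_shallow:
  assumes f: "abs_continuous_on {a..b} f" and "p < q"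
  shows "negligible (steep (\<lambda>x. - f x) (- p) {a..b} \<inter> steep f q {a..b})"
proof -
  \<comment> \<open>Leaving out the end points lets the open superset \<open>U\<close> stay inside
    \<open>{a<..<b}\<close>, hence also all covering intervals.\<close>
  define E where "E = steep (\<lambda>x. - f x) (- p) {a..b} \<inter> steep f q {a..b} \<inter> {a<..<b}"
  define m where "m = measure lebesgue E"
  \<comment> \<open>The errors of the final estimate: one \<open>\<epsilon>\<close> for comparing
    the two sums of increments, one for replacing the measure of \<open>T\<close> by
    \<open>m\<close>, three for replacing that of \<open>S\<close>.\<close>
  define c where "c = (1 + \<bar>p\<bar> + 3 * \<bar>q\<bar>) / (q - p)"
  have "E \<in> sets lebesgue"
    unfolding E_def by (intro sets.Int steep_sets) auto
  then have E: "E \<in> lmeasurable"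
    by (rule bounded_set_imp_lmeasurable[rotated]) (auto simp: E_def intro: bounded_subset[of "{a<..<b}"])
  have "m \<le> \<epsilon> * c" if "\<epsilon> > 0" "a \<le> b" for \<epsilon>
  proof -
    obtain \<delta>' where "\<delta>' > 0" and \<delta>': "\<And>\<C> \<D> S T. \<lbrakk>\<C> division_of S; \<D> division_of T; S \<subseteq> T;
        T \<subseteq> {a..b}; measure lebesgue T - measure lebesgue S < \<delta>'\<rbrakk>
      \<Longrightarrow> \<bar>(\<Sum>K\<in>\<D>. f (Sup K) - f (Inf K)) - (\<Sum>K\<in>\<C>. f (Sup K) - f (Inf K))\<bar> < \<epsilon>"
      using abs_continuous_on_refine[OF f \<open>\<epsilon> > 0\<close> \<open>a \<le> b\<close>] by blast
    \<comment> \<open>\<open>T\<close> has measure below \<open>m + \<delta>\<close> and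
      \<open>S\<close> measure above \<open>m - 3 * \<delta>\<close>, so the two differ by less than
      \<open>4 * \<delta>\<close>.\<close>
    define \<delta> where "\<delta> = min (\<delta>' / 4) \<epsilon>"
    have \<delta>: "\<delta> > 0" "4 * \<delta> \<le> \<delta>'" "\<delta> \<le> \<epsilon>"
      using \<open>\<delta>' > 0\<close> \<open>\<epsilon> > 0\<close> by (auto simp: \<delta>_def)
    obtain V where V: "open V" "E \<subseteq> V" "V - E \<in> lmeasurable" "emeasure lebesgue (V - E) < ennreal \<delta>"
      using sets_lebesgue_outer_open[OF \<open>E \<in> sets lebesgue\<close> \<open>\<delta> > 0\<close>] by blast
    define U where "U = V \<inter> {a<..<b}"
    have U: "open U" "E \<subseteq> U" "U \<subseteq> {a<..<b}"
      using V unfolding U_def E_def by auto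
    have Um: "U \<in> lmeasurable"
      by (rule bounded_set_imp_lmeasurable) (use U in \<open>auto intro: bounded_subset[of "{a<..<b}"]\<close>)
    have mU: "measure lebesgue U < m + \<delta>"
    proof -
      have "measure lebesgue (V - E) < \<delta>"
        using V(3,4) \<delta>(1) by (simp add: emeasure_eq_measure2 ennreal_less_iff)
      moreover have "measure lebesgue (U - E) \<le> measure lebesgue (V - E)"
        using V(3) Um E by (intro measure_mono_fmeasurable) (auto simp: U_def fmeasurable_def)
      moreover have "measure lebesgue U = m + measure lebesgue (U - E)"
        using measurable_measure_Diff[OF Um \<open>E \<in> sets lebesgue\<close> U(2)] unfolding m_def by simp
      ultimately show ?thesis
        by simp
    qed
    have shallow: "\<exists>u v. u < x \<and> x < v \<and> v - u < d \<and> f v - f u < p * (v - u)"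
      if "x \<in> E" "d > 0" for x d
    proof -
      have "x \<in> steep (\<lambda>x. - f x) (- p) {a..b}"
        using that unfolding E_def by blast
      then obtain u v where "u < x" "x < v" "v - u < d" "- f v - - f u > - p * (v - u)"
        using \<open>d > 0\<close> unfolding steep_def by blast
      then show ?thesis
        by (intro exI[of _ u] exI[of _ v]) simp
    qed
    obtain \<D> T where \<D>: "\<D> division_of T" "T \<subseteq> U"
      "measure lebesgue E - \<delta> < measure lebesgue T"
      "\<forall>K\<in>\<D>. Inf K < Sup K \<and> f (Sup K) - f (Inf K) < p * (Sup K - Inf K)"
      using Vitali_division[OF E U(1,2) \<delta>(1) shallow] by blast
    have mT: "m - \<delta> < measure lebesgue T"
      using \<D>(3) unfolding m_def .
    have Tm: "T \<in> lmeasurable"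
      using measure_division(2)[OF \<D>(1)] .
    \<comment> \<open>The second cover needs an open set to live in. Passing to interiors discards
      only finitely many frontiers, a null set.\<close>
    define W where "W = (\<Union>K\<in>\<D>. interior K)"
    have W: "open W" "W \<subseteq> T" "measure lebesgue T = measure lebesgue W"
    proof -
      show "open W"
        unfolding W_def by auto
      show "W \<subseteq> T"
        using division_ofD(6)[OF \<D>(1)] interior_subset unfolding W_def by blast
      have "negligible (\<Union>K\<in>\<D>. frontier K)"
        using division_ofD(1,4)[OF \<D>(1)]
        by (intro negligible_Union) (auto intro!: negligible_convex_frontier)
      moreover have "T - W \<subseteq> (\<Union>K\<in>\<D>. frontier K)"
        using division_ofD(6)[OF \<D>(1)] closure_subset unfolding W_def frontier_def by blast
      ultimately have "negligible ((T - W) \<union> (W - T))"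
        using \<open>W \<subseteq> T\<close> by (metis Diff_eq_empty_iff negligible_subset sup_bot.right_neutral)
      then show "measure lebesgue T = measure lebesgue W"
        using Tm measure_negligible_symdiff[of T W] by (metis fmeasurableD)
    qed
    have EW: "E \<inter> W \<in> lmeasurable" "m - 2 * \<delta> < measure lebesgue (E \<inter> W)"
    proof -
      show "E \<inter> W \<in> lmeasurable"
        using E W(1) by (simp add: fmeasurable_Int_fmeasurable lmeasurable_open borel_open)
      have Wm: "W \<in> sets lebesgue"
        using W(1) by (simp add: borel_open)
      have "W - E \<subseteq> U - E"
        using W(2) \<D>(2) by auto
      then have "measure lebesgue (W - E) \<le> measure lebesgue (U - E)"
        using Um E Wm by (intro measure_mono_fmeasurable) (auto simp: fmeasurable.Diff fmeasurableD)
      moreover have "measure lebesgue (U - E) < \<delta>"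
        using mU measurable_measure_Diff[OF Um \<open>E \<in> sets lebesgue\<close> U(2)] unfolding m_def by simp
      moreover have "measure lebesgue W \<le> measure lebesgue (E \<inter> W) + measure lebesgue (W - E)"
        using measure_Un_le[of "W \<inter> E" lebesgue "W - E"] Wm \<open>E \<in> sets lebesgue\<close>
        by (simp only: Int_Diff_Un Int_commute[of E W] sets.Int sets.Diff)
      ultimately show "m - 2 * \<delta> < measure lebesgue (E \<inter> W)"
        using mT W(3) by simp
    qed
    have steep: "\<exists>u v. u < x \<and> x < v \<and> v - u < d \<and> q * (v - u) < f v - f u"
      if "x \<in> E \<inter> W" "d > 0" for x d
    proof -
      have "x \<in> steep f q {a..b}"
        using that unfolding E_def by blast
      then show ?thesis
        using \<open>d > 0\<close> unfolding steep_def by blast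
    qed
    obtain \<C> S where \<C>: "\<C> division_of S" "S \<subseteq> W"
      "measure lebesgue (E \<inter> W) - \<delta> < measure lebesgue S"
      "\<forall>K\<in>\<C>. Inf K < Sup K \<and> q * (Sup K - Inf K) < f (Sup K) - f (Inf K)"
      using Vitali_division[OF EW(1) W(1) Int_lower2 \<delta>(1) steep] by blast
    have Sm: "S \<in> lmeasurable"
      using measure_division(2)[OF \<C>(1)] .
    have le: "measure lebesgue T \<le> measure lebesgue U" "measure lebesgue S \<le> measure lebesgue T"
      using \<D>(2) \<C>(2) W(2) Um Tm Sm by (auto intro!: measure_mono_fmeasurable)
    have "\<bar>(\<Sum>K\<in>\<D>. f (Sup K) - f (Inf K)) - (\<Sum>K\<in>\<C>. f (Sup K) - f (Inf K))\<bar> < \<epsilon>"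
      using \<delta>'[OF \<C>(1) \<D>(1)] \<C>(2,3) W(2) \<D>(2) U(3) EW(2) mU le \<delta>(2) by force
    moreover have "(\<Sum>K\<in>\<D>. f (Sup K) - f (Inf K)) \<le> p * measure lebesgue T"
      unfolding measure_division(1)[OF \<D>(1)] sum_distrib_left
      using \<D>(4) by (intro sum_mono) (auto intro: less_imp_le)
    moreover have "q * measure lebesgue S \<le> (\<Sum>K\<in>\<C>. f (Sup K) - f (Inf K))"
      unfolding measure_division(1)[OF \<C>(1)] sum_distrib_left
      using \<C>(4) by (intro sum_mono) (auto intro: less_imp_le)
    ultimately have "q * measure lebesgue S - p * measure lebesgue T \<le> \<epsilon>"
      by linarith
    moreover have "\<bar>q * (measure lebesgue S - m)\<bar> \<le> \<bar>q\<bar> * (3 * \<epsilon>)"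
      unfolding abs_mult using \<C>(3) EW(2) le mU \<delta>(1,3) by (intro mult_left_mono) auto
    moreover have "\<bar>p * (measure lebesgue T - m)\<bar> \<le> \<bar>p\<bar> * \<epsilon>"
      unfolding abs_mult using mT le mU \<delta>(1,3) by (intro mult_left_mono) auto
    ultimately have "(q - p) * m \<le> \<epsilon> * (1 + \<bar>p\<bar> + 3 * \<bar>q\<bar>)"
      by (simp add: algebra_simps)
    then show ?thesis
      using \<open>p < q\<close> unfolding c_def by (simp add: field_simps)
  qed
  note bound = this
  have "negligible E"
  proof (cases "a \<le> b")
    case True
    have "m \<le> 0"
    proof (rule field_le_epsilon)
      fix e :: real assume "e > 0"
      have "c > 0"
        using \<open>p < q\<close> unfolding c_def by (intro divide_pos_pos) auto
      then show "m \<le> 0 + e"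
        using bound[of "e / c"] \<open>e > 0\<close> True by simp
    qed
    then have "measure lebesgue E = 0"
      unfolding m_def using measure_nonneg[of lebesgue E] by linarith
    then show ?thesis
      using E by (simp add: negligible_iff_measure)
  next
    case False
    then show ?thesis
      by (simp add: E_def)
  qed
  moreover have "steep (\<lambda>x. - f x) (- p) {a..b} \<inter> steep f q {a..b} \<subseteq> E \<union> {a, b}"
    using steep_subset[of f q "{a..b}"] unfolding E_def by force
  ultimately show ?thesis
    by (meson negligible_Un negligible_finite negligible_subset finite.intros)
qed

text \<open>If a short piece of the set had measure \<open>m > 0\<close>, then for every
  \<open>n\<close> disjoint intervals of total length above \<open>m / 2\<close> and slope above
  \<open>n\<close> would have increments adding up to \<open>n * m / 2\<close> at least, while
  absolute continuity keeps this total below \<open>1\<close>.\<close>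

lemma negligible_infinite_slope:
  assumes f: "abs_continuous_on {a..b} f"
  shows "negligible (\<Inter>n::nat. steep f (real n) {a..b})"
proof -
  define E where "E = (\<Inter>n::nat. steep f (real n) {a..b})"
  have Es: "E \<in> sets lebesgue"
    unfolding E_def by (intro sets.countable_INT') (auto intro: steep_sets)
  obtain \<delta> where "\<delta> > 0" and \<delta>: "\<And>\<D> S. \<lbrakk>\<D> division_of S; S \<subseteq> {a..b}; measure lebesgue S < \<delta>\<rbrakk>
      \<Longrightarrow> (\<Sum>K\<in>\<D>. dist (f (Inf K)) (f (Sup K))) < 1"
    using abs_continuous_on_division[OF f zero_less_one] by blast
  \<comment> \<open>Disjoint intervals inside a ball of radius \<open>\<delta> / 3\<close> have
    total length below \<open>\<delta>\<close>, however many they are.\<close>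
  have small: "negligible (E \<inter> ball x (\<delta> / 3))" for x
  proof -
    define B where "B = ball x (\<delta> / 3)"
    define m where "m = measure lebesgue (E \<inter> B)"
    have B: "open B" "B \<in> lmeasurable" "measure lebesgue B < \<delta>"
      using \<open>\<delta> > 0\<close> unfolding B_def by (auto simp: ball_eq_greaterThanLessThan)
    have EB: "E \<inter> B \<in> lmeasurable"
      using fmeasurable_Int_fmeasurable[OF B(2) Es] by (simp add: Int_commute)
    have "m = 0"
    proof (rule ccontr)
      assume "m \<noteq> 0"
      then have "m > 0"
        using measure_nonneg[of lebesgue "E \<inter> B"] unfolding m_def by linarith
      then obtain n :: nat where n: "2 / m < real n"
        using reals_Archimedean2 by blast
      have ex: "\<exists>u v. u < y \<and> y < v \<and> v - u < d \<and> ({u..v} \<subseteq> {a..b} \<and> real n * (v - u) < f v - f u)"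
        if "y \<in> E \<inter> B" "d > 0" for y d
      proof -
        have "y \<in> steep f (real n) {a..b}"
          using that unfolding E_def by blast
        then show ?thesis
          using \<open>d > 0\<close> unfolding steep_def by blast
      qed
      have "m / 2 > 0"
        using \<open>m > 0\<close> by simp
      obtain \<D> S where \<D>: "\<D> division_of S" "S \<subseteq> B" "measure lebesgue (E \<inter> B) - m / 2 < measure lebesgue S"
        "\<forall>K\<in>\<D>. Inf K < Sup K \<and> ({Inf K..Sup K} \<subseteq> {a..b} \<and> real n * (Sup K - Inf K) < f (Sup K) - f (Inf K))"
        using Vitali_division[OF EB B(1) Int_lower2 \<open>m / 2 > 0\<close> ex] by blast
      have "S \<subseteq> {a..b}"
        using \<D>(4) division_of_real_interval(2)[OF \<D>(1)] division_ofD(6)[OF \<D>(1)] by (metis Sup_le_iff)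
      moreover have "measure lebesgue S < \<delta>"
        using measure_mono_fmeasurable[OF \<D>(2) _ B(2)] measure_division(2)[OF \<D>(1)] B(3)
        by (auto simp: fmeasurable_def)
      ultimately have "(\<Sum>K\<in>\<D>. dist (f (Inf K)) (f (Sup K))) < 1"
        using \<delta>[OF \<D>(1)] by blast
      moreover have "real n * measure lebesgue S \<le> (\<Sum>K\<in>\<D>. dist (f (Inf K)) (f (Sup K)))"
        unfolding measure_division(1)[OF \<D>(1)] sum_distrib_left
      proof (rule sum_mono)
        fix K assume "K \<in> \<D>"
        then show "real n * (Sup K - Inf K) \<le> dist (f (Inf K)) (f (Sup K))"
          using bspec[OF \<D>(4), of K] unfolding dist_real_def by linarith
      qed
      moreover have "real n * (m / 2) \<le> real n * measure lebesgue S"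
        using \<D>(3) unfolding m_def by (intro mult_left_mono) auto
      ultimately have "real n * (m / 2) < 1"
        by linarith
      then show False
        using n \<open>m > 0\<close> by (simp add: field_simps)
    qed
    then show ?thesis
      using EB unfolding m_def B_def by (simp add: negligible_iff_measure)
  qed
  \<comment> \<open>A set that is null near each of its points is null.\<close>
  have "negligible E"
  proof (subst locally_negligible_alt, intro ballI)
    fix x assume "x \<in> E"
    then show "\<exists>U. openin (top_of_set E) U \<and> x \<in> U \<and> negligible U"
      using small[of x] \<open>\<delta> > 0\<close> by (intro exI[of _ "E \<inter> ball x (\<delta> / 3)"]) (auto simp: openin_open_Int)
  qed
  then show ?thesis
    unfolding E_def .
qed

lemma steep_antimono: "p \<le> q \<Longrightarrow> steep f q T \<subseteq> steep f p T"
proof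
  fix x assume "p \<le> q" and x: "x \<in> steep f q T"
  show "x \<in> steep f p T"
    unfolding steep_def
  proof (intro CollectI allI impI)
    fix d :: real assume "d > 0"
    then obtain u v where uv: "u < x" "x < v" "v - u < d" "{u..v} \<subseteq> T" "f v - f u > q * (v - u)"
      using x unfolding steep_def by blast
    have "p * (v - u) \<le> q * (v - u)"
      using uv \<open>p \<le> q\<close> by (intro mult_right_mono) auto
    with uv(5) have "f v - f u > p * (v - u)"
      by linarith
    with uv show "\<exists>u v. u < x \<and> x < v \<and> v - u < d \<and> {u..v} \<subseteq> T \<and> f v - f u > p * (v - u)"
      by blast
  qed
qed

lemma not_steepD:
  assumes "x \<notin> steep f q T"
  shows "\<exists>d>0. \<forall>u v. u < x \<longrightarrow> x < v \<longrightarrow> v - u < d \<longrightarrow> {u..v} \<subseteq> T \<longrightarrow> f v - f u \<le> q * (v - u)"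
proof -
  obtain d where "d > 0" "\<not> (\<exists>u v. u < x \<and> x < v \<and> v - u < d \<and> {u..v} \<subseteq> T \<and> f v - f u > q * (v - u))"
    using assms unfolding steep_def by blast
  then show ?thesis
    by (meson not_le)
qed

text \<open>Straddling quotients do not see the value \<open>f x\<close>. Continuity supplies it:
  one end of the interval is kept at \<open>y\<close> and the other tends to \<open>x\<close>, and
  the estimate survives in the limit.\<close>

lemma has_real_derivative_straddle:
  assumes cont: "isCont f x"
    and straddle: "\<And>e. e > 0 \<Longrightarrow> \<exists>d>0. \<forall>u v. u < x \<and> x < v \<and> v - u < d \<longrightarrow>
      \<bar>f v - f u - D * (v - u)\<bar> \<le> e * (v - u)"
  shows "(f has_real_derivative D) (at x)"
  unfolding has_field_derivative_def has_derivative_within_alt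
proof (intro conjI allI impI)
  show "bounded_linear ((*) D)"
    by (rule bounded_linear_mult_right)
  fix e :: real assume "e > 0"
  then obtain d where "d > 0" and d: "\<And>u v. u < x \<and> x < v \<and> v - u < d \<Longrightarrow>
      \<bar>f v - f u - D * (v - u)\<bar> \<le> e * (v - u)"
    using straddle by blast
  have fx: "f \<midarrow>x\<rightarrow> f x"
    using cont by (simp add: isCont_def)
  then have left: "(f \<longlongrightarrow> f x) (at_left x)" and right: "(f \<longlongrightarrow> f x) (at_right x)"
    by (auto simp: filterlim_at_split)
  have "\<bar>f y - f x - D * (y - x)\<bar> \<le> e * \<bar>y - x\<bar>" if y: "\<bar>y - x\<bar> < d" for y
  proof -
    consider "y = x" | "y > x" | "y < x"
      by linarith
    then show ?thesis
    proof cases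
      case 2
      have "eventually (\<lambda>u. u \<in> {y - d<..<x}) (at_left x)"
        by (rule eventually_at_left_real) (use y in auto)
      then have "eventually (\<lambda>u. \<bar>f y - f u - D * (y - u)\<bar> \<le> e * (y - u)) (at_left x)"
        by (rule eventually_mono) (use 2 d in auto)
      moreover have "((\<lambda>u. \<bar>f y - f u - D * (y - u)\<bar>) \<longlongrightarrow> \<bar>f y - f x - D * (y - x)\<bar>) (at_left x)"
        by (intro tendsto_intros left)
      moreover have "((\<lambda>u. e * (y - u)) \<longlongrightarrow> e * (y - x)) (at_left x)"
        by (intro tendsto_intros)
      ultimately have "\<bar>f y - f x - D * (y - x)\<bar> \<le> e * (y - x)"
        by (intro tendsto_le[OF trivial_limit_at_left_real])
      then show ?thesis
        using 2 by simp
    next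
      case 3
      have "eventually (\<lambda>v. v \<in> {x<..<y + d}) (at_right x)"
        by (rule eventually_at_right_real) (use y in auto)
      then have "eventually (\<lambda>v. \<bar>f v - f y - D * (v - y)\<bar> \<le> e * (v - y)) (at_right x)"
        by (rule eventually_mono) (use 3 d in auto)
      moreover have "((\<lambda>v. \<bar>f v - f y - D * (v - y)\<bar>) \<longlongrightarrow> \<bar>f x - f y - D * (x - y)\<bar>) (at_right x)"
        by (intro tendsto_intros right)
      moreover have "((\<lambda>v. e * (v - y)) \<longlongrightarrow> e * (x - y)) (at_right x)"
        by (intro tendsto_intros)
      ultimately have "\<bar>f x - f y - D * (x - y)\<bar> \<le> e * (x - y)"
        by (intro tendsto_le[OF trivial_limit_at_right_real])
      then show ?thesis
        using 3 by (simp add: abs_if algebra_simps split: if_splits)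
    qed simp
  qed
  with \<open>d > 0\<close> show "\<exists>d>0. \<forall>y\<in>UNIV. norm (y - x) < d \<longrightarrow> norm (f y - f x - D * (y - x)) \<le> e * norm (y - x)"
    by (intro exI[of _ d]) simp
qed

theorem abs_continuous_on_differentiable_AE:
  fixes f :: "real \<Rightarrow> real"
  assumes f: "abs_continuous_on {a..b} f"
  shows "AE x\<in>{a<..<b} in lebesgue. f differentiable at x"
proof -
  let ?T = "{a..b}"
  have mf: "abs_continuous_on ?T (\<lambda>x. - f x)"
    by (rule abs_continuous_on_compose[OF f, of _ 1]) (simp add: dist_real_def abs_minus_commute)
  \<comment> \<open>Bad points are those with slopes unbounded above, with slopes unbounded below,
    or with slopes both below \<open>p\<close> and above \<open>q\<close> at all scales. Rational
    \<open>p < q\<close> keep the union countable.\<close>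
  define N where "N = (\<Inter>n::nat. steep f (real n) ?T) \<union> (\<Inter>n::nat. steep (\<lambda>x. - f x) (real n) ?T)
    \<union> (\<Union>(p, q)\<in>{(p, q). p \<in> \<rat> \<and> q \<in> \<rat> \<and> p < q}. steep (\<lambda>x. - f x) (- p) ?T \<inter> steep f q ?T)"
  have "countable {(p, q). p \<in> \<rat> \<and> q \<in> \<rat> \<and> p < (q::real)}"
    by (rule countable_subset[of _ "\<rat> \<times> \<rat>"]) (auto intro: countable_rat)
  then have "negligible N"
    unfolding N_def using negligible_infinite_slope[OF f] negligible_infinite_slope[OF mf]
    by (intro negligible_Un negligible_countable_Union countable_image)
      (auto intro: negligible_steep_shallow[OF f])
  moreover have "f differentiable at x" if x: "x \<in> {a<..<b}" "x \<notin> N" for x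
  proof -
    \<comment> \<open>The supremum of \<open>Q\<close> is the upper limit of the straddling slopes
      and will be the derivative.\<close>
    define Q where "Q = {q. x \<in> steep f q ?T}"
    have interval: "\<exists>u v. u < x \<and> x < v \<and> v - u < d \<and> {u..v} \<subseteq> ?T" if "d > 0" for d
    proof -
      define e where "e = min (d / 3) (min (x - a) (b - x))"
      have "e > 0"
        using x that by (simp add: e_def)
      moreover have "e \<le> d / 3" "{x - e..x + e} \<subseteq> ?T"
        unfolding e_def by (rule min.cobounded1, auto)
      ultimately show ?thesis
        using that by (intro exI[of _ "x - e"] exI[of _ "x + e"]) simp
    qed
    obtain n :: nat where "x \<notin> steep f (real n) ?T"
      using x(2) unfolding N_def by blast
    then have bdd: "q < real n" if "q \<in> Q" for q
      using steep_antimono[of "real n" q f ?T] that unfolding Q_def by (meson mem_Collect_eq not_less subsetD)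
    then have "bdd_above Q"
      by (meson bdd_aboveI less_imp_le)
    obtain k :: nat where "x \<notin> steep (\<lambda>x. - f x) (real k) ?T"
      using x(2) unfolding N_def by blast
    then obtain d where "d > 0" and
      d: "\<And>u v. \<lbrakk>u < x; x < v; v - u < d; {u..v} \<subseteq> ?T\<rbrakk> \<Longrightarrow> - f v - - f u \<le> real k * (v - u)"
      using not_steepD by blast
    \<comment> \<open>Slopes of short intervals are at least \<open>- real k\<close>; subtracting
      \<open>1\<close> gives the strict inequality in \<open>steep\<close>.\<close>
    have "- real k - 1 \<in> Q"
      unfolding Q_def steep_def
    proof (intro CollectI allI impI)
      fix d' :: real assume "d' > 0"
      then obtain u v where uv: "u < x" "x < v" "v - u < min d d'" "{u..v} \<subseteq> ?T"
        using interval[of "min d d'"] \<open>d > 0\<close> by auto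
      then have "(- real k - 1) * (v - u) < f v - f u"
        using d[of u v] by (simp add: algebra_simps)
      then show "\<exists>u v. u < x \<and> x < v \<and> v - u < d' \<and> {u..v} \<subseteq> ?T \<and> f v - f u > (- real k - 1) * (v - u)"
        using uv by (intro exI[of _ u] exI[of _ v]) simp
    qed
    then have "Q \<noteq> {}"
      by blast
    define D where "D = Sup Q"
    have above: "x \<notin> steep f (D + e) ?T" if "e > 0" for e
      using cSup_upper[OF _ \<open>bdd_above Q\<close>, of "D + e"] that unfolding D_def Q_def by auto
    have below: "x \<notin> steep (\<lambda>x. - f x) (- (D - e)) ?T" if "e > 0" for e
    proof
      assume *: "x \<in> steep (\<lambda>x. - f x) (- (D - e)) ?T"
      \<comment> \<open>Slopes below \<open>D - e\<close> at all scales would leave room for two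
        rationals \<open>r < s\<close> under \<open>D\<close>, and this gap puts \<open>x\<close>
        into \<open>N\<close>.\<close>
      obtain r where r: "r \<in> \<rat>" "D - e < r" "r < D"
        using Rats_dense_in_real[of "D - e" D] \<open>e > 0\<close> by auto
      then obtain s where s: "s \<in> \<rat>" "r < s" "s < D"
        using Rats_dense_in_real[of r D] by auto
      then obtain q where "q \<in> Q" "s < q"
        using less_cSup_iff[OF \<open>Q \<noteq> {}\<close> \<open>bdd_above Q\<close>] unfolding D_def by blast
      then have "x \<in> steep f s ?T"
        using steep_antimono[of s q f ?T] unfolding Q_def by auto
      moreover have "x \<in> steep (\<lambda>x. - f x) (- r) ?T"
        using steep_antimono[of "- r" "- (D - e)" "\<lambda>x. - f x" ?T] * r by auto
      ultimately have "x \<in> N"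
        unfolding N_def using r s by blast
      with x show False
        by blast
    qed
    have "isCont f x"
      using abs_continuous_on_imp_continuous_on[OF f] x(1)
      by (simp add: continuous_on_interior)
    then have "(f has_real_derivative D) (at x)"
    proof (rule has_real_derivative_straddle)
      fix e :: real assume "e > 0"
      obtain d1 where "d1 > 0" and d1: "\<And>u v. \<lbrakk>u < x; x < v; v - u < d1; {u..v} \<subseteq> ?T\<rbrakk> \<Longrightarrow>
          f v - f u \<le> (D + e) * (v - u)"
        using not_steepD[OF above[OF \<open>e > 0\<close>]] by blast
      obtain d2 where "d2 > 0" and d2: "\<And>u v. \<lbrakk>u < x; x < v; v - u < d2; {u..v} \<subseteq> ?T\<rbrakk> \<Longrightarrow>
          - f v - - f u \<le> - (D - e) * (v - u)"
        using not_steepD[OF below[OF \<open>e > 0\<close>]] by blast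
      define d where "d = min (min d1 d2) (min (x - a) (b - x))"
      have "d > 0"
        using x \<open>d1 > 0\<close> \<open>d2 > 0\<close> by (simp add: d_def)
      moreover have "\<bar>f v - f u - D * (v - u)\<bar> \<le> e * (v - u)" if "u < x" "x < v" "v - u < d" for u v
      proof -
        have "{u..v} \<subseteq> ?T"
          using that unfolding d_def by auto
        then show ?thesis
          using d1[of u v] d2[of u v] that unfolding d_def by (simp add: abs_le_iff algebra_simps)
      qed
      ultimately show "\<exists>d>0. \<forall>u v. u < x \<and> x < v \<and> v - u < d \<longrightarrow>
          \<bar>f v - f u - D * (v - u)\<bar> \<le> e * (v - u)"
        by blast
    qed
    then show ?thesis
      using real_differentiable_def by blast
  qed
  ultimately show ?thesis
    by (intro AE_I'[of N]) (auto simp: negligible_iff_null_sets)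
qed

subsection \<open>The fundamental theorem of calculus\<close>

lemma AE_in_negligibleE:
  assumes "AE x\<in>S in lebesgue. P x"
  obtains N where "negligible N" "\<And>x. x \<in> S \<Longrightarrow> x \<notin> N \<Longrightarrow> P x"
proof -
  obtain N where "{x \<in> space lebesgue. \<not> (x \<in> S \<longrightarrow> P x)} \<subseteq> N" "emeasure lebesgue N = 0" "N \<in> sets lebesgue"
    using AE_E[OF assms] by blast
  then show thesis
    using that[of N] by (auto simp: negligible_iff_null_sets null_sets_def)
qed

text \<open>An interval carrying several tags is degenerate, so its increment vanishes and
  forgetting the tags does not change the sum.\<close>

lemma sum_tagged_increments:
  fixes f :: "real \<Rightarrow> real"
  assumes "p tagged_partial_division_of S"
  shows "(\<Sum>(x, K)\<in>p. \<bar>f (Sup K) - f (Inf K)\<bar>) = (\<Sum>K\<in>snd ` p. dist (f (Inf K)) (f (Sup K)))"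
proof -
  \<comment> \<open>The empty set counts as a box with empty interior, and there \<open>Inf\<close>
    and \<open>Sup\<close> are arbitrary; the value \<open>0\<close> is imposed.\<close>
  define d where "d K = (if K = {} then 0 else dist (f (Inf K)) (f (Sup K)))" for K
  have ne: "K \<noteq> {}" if "(x, K) \<in> p" for x K
    using tagged_partial_division_ofD(2)[OF assms that] by blast
  have "(\<Sum>(x, K)\<in>p. d K) = sum d (snd ` p)"
  proof (rule sum.over_tagged_division_lemma[OF tagged_partial_division_of_Union_self[OF assms]])
    fix u v :: real assume "box u v = {}"
    then show "d (cbox u v) = 0"
      unfolding d_def by auto
  qed
  moreover have "(\<Sum>(x, K)\<in>p. d K) = (\<Sum>(x, K)\<in>p. \<bar>f (Sup K) - f (Inf K)\<bar>)"
    using ne by (intro sum.cong) (auto simp: d_def dist_real_def)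
  moreover have "sum d (snd ` p) = (\<Sum>K\<in>snd ` p. dist (f (Inf K)) (f (Sup K)))"
    using ne by (intro sum.cong) (auto simp: d_def)
  ultimately show ?thesis
    by simp
qed

text \<open>Tags in the exceptional null set sit in intervals of small total length, whose increments are
  controlled by absolute continuity. At the remaining tags the derivative exists.\<close>

theorem abs_continuous_on_has_integral:
  fixes f g :: "real \<Rightarrow> real"
  assumes f: "abs_continuous_on {a..b} f" and "a \<le> b"
    and g: "AE x\<in>{a<..<b} in lebesgue. (f has_real_derivative g x) (at x)"
  shows "(g has_integral (f b - f a)) {a..b}"
proof (cases "a = b")
  case True
  then show ?thesis
    by (simp add: has_integral_refl)
next
  case False
  then have "a < b"
    using \<open>a \<le> b\<close> by simp
  obtain N0 where N0: "negligible N0"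
    "\<And>x. x \<in> {a<..<b} \<Longrightarrow> x \<notin> N0 \<Longrightarrow> (f has_real_derivative g x) (at x)"
    using AE_in_negligibleE[OF g] by blast
  \<comment> \<open>The end points may occur as tags, but differentiability is known only inside the
    interval.\<close>
  define N where "N = N0 \<union> {a, b}"
  have N: "negligible N" "N \<in> sets lebesgue"
  proof -
    show "negligible N"
      using N0(1) unfolding N_def by (intro negligible_Un) auto
    then show "N \<in> sets lebesgue"
      by (rule negligible_imp_sets)
  qed
  \<comment> \<open>With value \<open>0\<close> on \<open>N\<close>, a tag there contributes nothing
    but the increment of \<open>f\<close>. The change on a null set is undone at the end.\<close>
  define g0 where "g0 x = (if x \<in> N then 0 else g x)" for x
  have "(g0 has_integral (f b - f a)) {a..b}"
    unfolding has_integral_factor_content_real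
  proof (intro allI impI)
    fix e :: real assume "e > 0"
    have "\<exists>d>0. x \<in> {a..b} - N \<longrightarrow> (\<forall>y. \<bar>y - x\<bar> < d \<longrightarrow>
        \<bar>f y - f x - g x * (y - x)\<bar> \<le> e / 2 * \<bar>y - x\<bar>)" for x
    proof (cases "x \<in> {a..b} - N")
      case True
      then have "(f has_real_derivative g x) (at x)"
        using N0(2)[of x] unfolding N_def by auto
      then have "\<forall>e>0. \<exists>d>0. \<forall>y\<in>UNIV. norm (y - x) < d \<longrightarrow> norm (f y - f x - g x * (y - x)) \<le> e * norm (y - x)"
        unfolding has_field_derivative_def has_derivative_within_alt by blast
      moreover have "e / 2 > 0"
        using \<open>e > 0\<close> by simp
      ultimately show ?thesis
        unfolding real_norm_def by (metis UNIV_I)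
    next
      case False
      then show ?thesis
        by (intro exI[of _ 1]) auto
    qed
    then obtain d where d: "\<And>x. d x > 0" "\<And>x y. x \<in> {a..b} - N \<Longrightarrow> \<bar>y - x\<bar> < d x \<Longrightarrow>
        \<bar>f y - f x - g x * (y - x)\<bar> \<le> e / 2 * \<bar>y - x\<bar>"
      by metis
    have "e * (b - a) / 2 > 0"
      using \<open>e > 0\<close> \<open>a < b\<close> by simp
    then obtain \<delta> where "\<delta> > 0" and \<delta>: "\<And>\<D> S. \<lbrakk>\<D> division_of S; S \<subseteq> {a..b}; measure lebesgue S < \<delta>\<rbrakk>
        \<Longrightarrow> (\<Sum>K\<in>\<D>. dist (f (Inf K)) (f (Sup K))) < e * (b - a) / 2"
      using abs_continuous_on_division[OF f] by blast
    obtain U where U: "open U" "N \<subseteq> U" "U - N \<in> lmeasurable" "emeasure lebesgue (U - N) < ennreal \<delta>"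
      using sets_lebesgue_outer_open[OF N(2) \<open>\<delta> > 0\<close>] by blast
    have Um: "U \<in> lmeasurable" "measure lebesgue U < \<delta>"
    proof -
      have "N \<in> lmeasurable" "measure lebesgue N = 0"
        using N(1) by (auto simp: negligible_iff_measure)
      moreover have "U = (U - N) \<union> N"
        using U(2) by auto
      ultimately show "U \<in> lmeasurable"
        using U(3) by (metis fmeasurable.Un)
      have "measure lebesgue U \<le> measure lebesgue (U - N) + measure lebesgue N"
        using measure_Un_le[of "U - N" lebesgue N] U(3) N(2) \<open>U = (U - N) \<union> N\<close>
        by (metis fmeasurableD)
      also have "\<dots> = measure lebesgue (U - N)"
        using \<open>measure lebesgue N = 0\<close> by simp
      also have "\<dots> < \<delta>"
        using U(3,4) \<open>\<delta> > 0\<close> by (simp add: emeasure_eq_measure2 ennreal_less_iff)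
      finally show "measure lebesgue U < \<delta>" .
    qed
    define G where "G x = (if x \<in> N then U else ball x (d x))" for x
    show "\<exists>G. gauge G \<and> (\<forall>p. p tagged_division_of {a..b} \<and> G fine p \<longrightarrow>
      norm ((\<Sum>(x, K)\<in>p. measure lborel K *\<^sub>R g0 x) - (f b - f a)) \<le> e * measure lborel {a..b})"
    proof (intro exI[of _ G] conjI allI impI)
      show "gauge G"
        unfolding gauge_def G_def using U(1,2) d(1) by auto
      fix p assume "p tagged_division_of {a..b} \<and> G fine p"
      then have p: "p tagged_division_of {a..b}" and fine: "G fine p"
        by auto
      define p1 where "p1 = {(x, K) \<in> p. x \<in> N}"
      define r where "r = (\<lambda>(x, K). measure lborel K *\<^sub>R g0 x - (f (Sup K) - f (Inf K)))"
      have "finite p"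
        using p by blast
      have p1: "p1 \<subseteq> p" "finite p1"
      proof -
        show "p1 \<subseteq> p"
          unfolding p1_def by auto
        then show "finite p1"
          using \<open>finite p\<close> finite_subset by blast
      qed
      have K: "K = {Inf K..Sup K}" "Inf K \<le> x" "x \<le> Sup K" "K \<subseteq> {a..b}" if "(x, K) \<in> p" for x K
        using tagged_division_ofD(2-4)[OF p that] by auto
      have b1: "\<bar>sum r p1\<bar> \<le> e * (b - a) / 2"
      proof -
        have tp1: "p1 tagged_partial_division_of {a..b}"
          using p p1(1) tagged_partial_division_subset tagged_division_of_def by blast
        have div: "snd ` p1 division_of \<Union>(snd ` p1)"
          using partial_division_of_tagged_division[OF tp1] .
        have "\<Union>(snd ` p1) \<subseteq> U"
          using fine unfolding fine_def p1_def G_def by fastforce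
        then have "measure lebesgue (\<Union>(snd ` p1)) < \<delta>"
          using measure_mono_fmeasurable[of "\<Union>(snd ` p1)" U lebesgue] measure_division(2)[OF div] Um
          by (auto simp: fmeasurable_def)
        moreover have "\<Union>(snd ` p1) \<subseteq> {a..b}"
          using K(4) p1(1) by fastforce
        ultimately have "(\<Sum>K\<in>snd ` p1. dist (f (Inf K)) (f (Sup K))) < e * (b - a) / 2"
          using \<delta>[OF div] by blast
        moreover have "(\<Sum>z\<in>p1. \<bar>r z\<bar>) = (\<Sum>(x, K)\<in>p1. \<bar>f (Sup K) - f (Inf K)\<bar>)"
          by (rule sum.cong) (auto simp: r_def p1_def g0_def)
        then have "\<bar>sum r p1\<bar> \<le> (\<Sum>(x, K)\<in>p1. \<bar>f (Sup K) - f (Inf K)\<bar>)"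
          using sum_abs[of r p1] by simp
        ultimately show ?thesis
          using sum_tagged_increments[OF tp1, of f] by linarith
      qed
      have b2: "\<bar>sum r (p - p1)\<bar> \<le> e * (b - a) / 2"
      proof -
        have "\<bar>r z\<bar> \<le> e / 2 * (Sup (snd z) - Inf (snd z))" if z: "z \<in> p - p1" for z
        proof -
          obtain x K where zxK: "z = (x, K)" "(x, K) \<in> p" "x \<notin> N"
            using z unfolding p1_def by (cases z) auto
          note K' = K[OF zxK(2)]
          have x: "x \<in> {a..b} - N"
            using tag_in_interval[OF p zxK(2)] zxK(3) by blast
          have "K \<subseteq> ball x (d x)"
            using fineD[OF fine zxK(2)] zxK(3) by (simp add: G_def)
          moreover have "Inf K \<in> K" "Sup K \<in> K"
            using K'(1,2,3) by (metis atLeastAtMost_iff order_refl order_trans)+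
          ultimately have "\<bar>Inf K - x\<bar> < d x" "\<bar>Sup K - x\<bar> < d x"
            by (auto simp: dist_real_def abs_minus_commute)
          then have "\<bar>f (Inf K) - f x - g x * (Inf K - x)\<bar> \<le> e / 2 * (x - Inf K)"
            "\<bar>f (Sup K) - f x - g x * (Sup K - x)\<bar> \<le> e / 2 * (Sup K - x)"
            using d(2)[OF x, of "Inf K"] d(2)[OF x, of "Sup K"] K'(2,3) by auto
          moreover have "measure lborel K = Sup K - Inf K"
            using K'(2,3) by (subst K'(1)) simp
          then have "r z = (Sup K - Inf K) * g x - (f (Sup K) - f (Inf K))"
            using zxK unfolding r_def g0_def by simp
          \<comment> \<open>Both ends of \<open>K\<close> are compared with the tag between them, so
            the two errors add up to \<open>e / 2\<close> times the length of
            \<open>K\<close>.\<close>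
          then have "r z = (f (Inf K) - f x - g x * (Inf K - x)) - (f (Sup K) - f x - g x * (Sup K - x))"
            by (simp add: algebra_simps)
          moreover have "e / 2 * (x - Inf K) + e / 2 * (Sup K - x) = e / 2 * (Sup K - Inf K)"
            by (simp add: field_simps)
          ultimately have "\<bar>r z\<bar> \<le> e / 2 * (Sup K - Inf K)"
            by linarith
          then show ?thesis
            using zxK(1) by simp
        qed
        then have "\<bar>sum r (p - p1)\<bar> \<le> (\<Sum>z\<in>p - p1. e / 2 * (Sup (snd z) - Inf (snd z)))"
          using sum_abs[of r "p - p1"] sum_mono[of "p - p1" "\<lambda>z. \<bar>r z\<bar>"] by (meson order_trans)
        also have "\<dots> \<le> (\<Sum>z\<in>p. e / 2 * (Sup (snd z) - Inf (snd z)))"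
        proof (rule sum_mono2[OF \<open>finite p\<close>])
          fix z assume "z \<in> p - (p - p1)"
          then have "(fst z, snd z) \<in> p"
            using p1(1) by auto
          then show "0 \<le> e / 2 * (Sup (snd z) - Inf (snd z))"
            using K(2,3) \<open>e > 0\<close> by fastforce
        qed auto
        also have "\<dots> = e / 2 * (b - a)"
          using additive_tagged_division_1[OF \<open>a \<le> b\<close> p, of "\<lambda>x. x"]
          unfolding sum_distrib_left[symmetric] by (simp add: case_prod_beta)
        finally show ?thesis
          by simp
      qed
      have "(\<Sum>(x, K)\<in>p. measure lborel K *\<^sub>R g0 x) - (f b - f a) = sum r p"
        using additive_tagged_division_1[OF \<open>a \<le> b\<close> p, of f]
        by (simp add: r_def sum_subtractf case_prod_beta)
      also have "\<dots> = sum r (p - p1) + sum r p1"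
        using sum.subset_diff[OF p1(1) \<open>finite p\<close>] .
      finally have "norm ((\<Sum>(x, K)\<in>p. measure lborel K *\<^sub>R g0 x) - (f b - f a)) \<le> e * (b - a)"
        using b1 b2 by (simp add: field_simps)
      then show "norm ((\<Sum>(x, K)\<in>p. measure lborel K *\<^sub>R g0 x) - (f b - f a)) \<le> e * measure lborel {a..b}"
        using \<open>a \<le> b\<close> by simp
    qed
  qed
  then show ?thesis
    by (rule has_integral_spike[OF N(1), rotated]) (simp add: g0_def)
qed

section \<open>Absolute integrability of the derivative\<close>

lemma AE_Ioo_subset:
  assumes "AE x\<in>{a<..<b} in lebesgue. P x" "{u..v} \<subseteq> {a..b::real}"
  shows "AE x\<in>{u<..<v} in lebesgue. P x"
proof -
  have "{u<..<v} \<subseteq> {a<..<b}"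
    using interior_mono[OF assms(2)] by simp
  then show ?thesis
    using assms(1) by (auto elim!: eventually_mono)
qed

text \<open>The integral over a subinterval is an increment of \<open>f\<close>, so bounded
  variation of \<open>f\<close> gives absolute integrability. Intervals shorter than
  \<open>\<delta>\<close> have variation at most \<open>1\<close>, and a Bolzano argument glues
  them.\<close>

theorem abs_continuous_on_absolutely_integrable:
  fixes f g :: "real \<Rightarrow> real"
  assumes f: "abs_continuous_on {a..b} f"
    and g: "AE x\<in>{a<..<b} in lebesgue. (f has_real_derivative g x) (at x)"
  shows "g absolutely_integrable_on {a..b}"
proof (cases "a \<le> b")
  case True
  obtain \<delta> where "\<delta> > 0" and \<delta>: "\<And>\<D> S. \<lbrakk>\<D> division_of S; S \<subseteq> {a..b}; measure lebesgue S < \<delta>\<rbrakk>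
      \<Longrightarrow> (\<Sum>K\<in>\<D>. dist (f (Inf K)) (f (Sup K))) < 1"
    using abs_continuous_on_division[OF f zero_less_one] by blast
  have int: "(g has_integral (f v - f u)) {u..v}" if "u \<le> v" "{u..v} \<subseteq> {a..b}" for u v
    using abs_continuous_on_has_integral[OF abs_continuous_on_subset[OF f that(2)] that(1)
        AE_Ioo_subset[OF g that(2)]] .
  \<comment> \<open>Naming the ambient interval keeps it fixed while the induction varies the end
    points.\<close>
  define T where "T = {a..b}"
  have "{a..b} \<subseteq> T \<longrightarrow> g absolutely_integrable_on {a..b}"
    using True
  proof (induction rule: Bolzano)
    case (trans u w v)
    then have "{u..w} \<subseteq> {u..v}" "{w..v} \<subseteq> {u..v}"
      by auto
    with trans show ?case
      by (meson absolutely_integrable_on_combine order_trans)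
  next
    case (local x)
    have "g absolutely_integrable_on {u..v}" if "u \<le> x" "x \<le> v" "v - u < \<delta>" "{u..v} \<subseteq> T" for u v
      unfolding box_real(2)[symmetric]
    proof (rule bounded_variation_absolutely_integrable_interval[of _ _ _ 1])
      show "g integrable_on cbox u v"
        using int[of u v] that unfolding T_def by (auto simp: integrable_on_def)
      fix \<D> assume "\<D> division_of cbox u v"
      then have \<D>: "\<D> division_of {u..v}"
        by simp
      have "norm (integral K g) = dist (f (Inf K)) (f (Sup K))" if "K \<in> \<D>" for K
      proof -
        note K = division_of_real_interval[OF \<D> that]
        have "(g has_integral (f (Sup K) - f (Inf K))) K"
          using int[OF K(1)] K(3) \<open>{u..v} \<subseteq> T\<close> unfolding T_def by (subst K(2)) auto
        then show ?thesis
          by (simp add: integral_unique dist_real_def abs_minus_commute)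
      qed
      then show "(\<Sum>K\<in>\<D>. norm (integral K g)) \<le> 1"
        using \<delta>[OF \<D>] that unfolding T_def by (auto intro: less_imp_le)
    qed
    with \<open>\<delta> > 0\<close> show ?case
      by blast
  qed
  then show ?thesis
    unfolding T_def by blast
qed (simp add: absolutely_integrable_on_def)

text \<open>Transfers the gauge integral to the Bochner integral over the open interval, the form
  used in \<open>resistance\<close> and \<open>admissible\<close>.\<close>

lemma abs_continuous_on_LINT_derivative:
  fixes f g :: "real \<Rightarrow> real"
  assumes "abs_continuous_on {a..b} f" "a \<le> b"
    and "AE x\<in>{a<..<b} in lebesgue. (f has_real_derivative g x) (at x)"
  shows "set_integrable lebesgue {a<..<b} g" "(LINT x:{a<..<b}|lebesgue. g x) = f b - f a"
proof -
  show int: "set_integrable lebesgue {a<..<b} g"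
    by (rule set_integrable_subset[OF abs_continuous_on_absolutely_integrable[OF assms(1,3)]]) auto
  show "(LINT x:{a<..<b}|lebesgue. g x) = f b - f a"
    using set_lebesgue_integral_eq_integral(2)[OF int] integral_open_interval_real[of a b g]
      integral_unique[OF abs_continuous_on_has_integral[OF assms]] by simp
qed

section \<open>Monotonicity and constancy from the sign of the derivative\<close>

lemma abs_continuous_on_mono:
  fixes f g :: "real \<Rightarrow> real"
  assumes f: "abs_continuous_on {a..b} f"
    and g: "AE x\<in>{a<..<b} in lebesgue. (f has_real_derivative g x) (at x) \<and> g x \<ge> 0"
  shows "mono_on {a..b} f"
proof (rule mono_onI)
  fix u v assume uv: "u \<in> {a..b}" "v \<in> {a..b}" "u \<le> v"
  then have sub: "{u..v} \<subseteq> {a..b}"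
    by auto
  note g' = AE_Ioo_subset[OF g sub]
  have "f v - f u = (LINT x:{u<..<v}|lebesgue. g x)"
    using g' by (intro abs_continuous_on_LINT_derivative(2)[OF abs_continuous_on_subset[OF f sub] uv(3), symmetric])
      (auto elim: eventually_mono)
  also have "\<dots> \<ge> 0"
    unfolding set_lebesgue_integral_def
    by (rule integral_nonneg_AE) (use g' in \<open>auto elim!: eventually_mono simp: indicator_def\<close>)
  finally show "f u \<le> f v"
    by simp
qed

text \<open>Both \<open>f\<close> and \<open>- f\<close> are nondecreasing.\<close>

lemma abs_continuous_on_const:
  fixes f :: "real \<Rightarrow> real"
  assumes f: "abs_continuous_on {a..b} f"
    and "AE x\<in>{a<..<b} in lebesgue. (f has_real_derivative 0) (at x)"
    and "u \<in> {a..b}" "v \<in> {a..b}"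
  shows "f u = f v"
proof -
  have mf: "abs_continuous_on {a..b} (\<lambda>x. - f x)"
    by (rule abs_continuous_on_compose[OF f, of _ 1]) (simp add: dist_real_def abs_minus_commute)
  have m: "mono_on {a..b} f"
    by (rule abs_continuous_on_mono[OF f, of "\<lambda>_. 0"]) (use assms(2) in simp)
  have "AE x\<in>{a<..<b} in lebesgue. ((\<lambda>x. - f x) has_real_derivative 0) (at x)"
    using assms(2) by (rule eventually_mono) (metis DERIV_minus minus_zero)
  then have m': "mono_on {a..b} (\<lambda>x. - f x)"
    by (intro abs_continuous_on_mono[OF mf, of "\<lambda>_. 0"]) simp
  show ?thesis
    using mono_onD[OF m assms(3,4)] mono_onD[OF m' assms(3,4)] mono_onD[OF m assms(4,3)]
      mono_onD[OF m' assms(4,3)] by linarith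
qed

section \<open>Components of plane curves\<close>

lemma abs_continuous_on_fst:
  "abs_continuous_on T \<gamma> \<Longrightarrow> abs_continuous_on T (\<lambda>t. fst (\<gamma> t))"
  by (rule abs_continuous_on_compose[of _ _ _ 1]) (auto simp: dist_fst_le)

lemma abs_continuous_on_snd:
  "abs_continuous_on T \<gamma> \<Longrightarrow> abs_continuous_on T (\<lambda>t. snd (\<gamma> t))"
  by (rule abs_continuous_on_compose[of _ _ _ 1]) (auto simp: dist_snd_le)

text \<open>Almost everywhere both components are differentiable, hence so is the pair;
  \<open>D1\<close> and \<open>D2\<close> are then true derivatives and not default values of
  \<open>vector_derivative\<close>.\<close>

lemma abs_continuous_on_curve_derivative:
  fixes \<gamma> :: "real \<Rightarrow> real \<times> real"
  assumes \<gamma>: "abs_continuous_on {a..b} \<gamma>"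
  shows "AE t\<in>{a<..<b} in lebesgue. ((\<lambda>t. fst (\<gamma> t)) has_real_derivative D1 \<gamma> t) (at t) \<and>
    ((\<lambda>t. snd (\<gamma> t)) has_real_derivative D2 \<gamma> t) (at t)"
  using abs_continuous_on_differentiable_AE[OF abs_continuous_on_fst[OF \<gamma>]]
    abs_continuous_on_differentiable_AE[OF abs_continuous_on_snd[OF \<gamma>]]
proof eventually_elim
  case (elim t)
  show ?case
  proof
    assume "t \<in> {a<..<b}"
    then obtain x y where xy: "((\<lambda>t. fst (\<gamma> t)) has_real_derivative x) (at t)"
      "((\<lambda>t. snd (\<gamma> t)) has_real_derivative y) (at t)"
      using elim by (auto simp: real_differentiable_def)
    then have "((\<lambda>t. (fst (\<gamma> t), snd (\<gamma> t))) has_vector_derivative (x, y)) (at t)"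
      by (intro has_vector_derivative_Pair) (simp_all add: has_real_derivative_iff_has_vector_derivative)
    then have "vector_derivative \<gamma> (at t) = (x, y)"
      by (simp add: vector_derivative_at)
    with xy show "((\<lambda>t. fst (\<gamma> t)) has_real_derivative D1 \<gamma> t) (at t) \<and>
        ((\<lambda>t. snd (\<gamma> t)) has_real_derivative D2 \<gamma> t) (at t)"
      by simp
  qed
qed

subsection \<open>The resistance functional\<close>

text \<open>For \<open>y \<ge> 0\<close> the difference of the two sides, multiplied by \<open>x\<^sup>2 + y\<^sup>2\<close>, is
  \<open>x (x - y)\<^sup>2 / 2\<close>.\<close>

lemma newton_integrand_ge:
  fixes x y :: real
  assumes "x \<ge> 0" "x \<noteq> 0 \<or> y \<noteq> 0"
  shows "y - x / 2 \<le> (max y 0) ^ 3 / (x\<^sup>2 + y\<^sup>2)"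
    and "(max y 0) ^ 3 / (x\<^sup>2 + y\<^sup>2) = y - x / 2 \<longleftrightarrow> y \<ge> 0 \<and> (x > 0 \<longrightarrow> x = y)"
proof -
  have pos: "x\<^sup>2 + y\<^sup>2 > 0"
    using assms(2) by (simp add: sum_power2_gt_zero_iff)
  have "y - x / 2 \<le> (max y 0) ^ 3 / (x\<^sup>2 + y\<^sup>2) \<and>
    ((max y 0) ^ 3 / (x\<^sup>2 + y\<^sup>2) = y - x / 2 \<longleftrightarrow> y \<ge> 0 \<and> (x > 0 \<longrightarrow> x = y))"
  proof (cases "y \<ge> 0")
    case True
    have "y ^ 3 - (y - x / 2) * (x\<^sup>2 + y\<^sup>2) = x * (x - y)\<^sup>2 / 2"
      by (simp add: field_simps power2_eq_square power3_eq_cube)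
    then have *: "y ^ 3 / (x\<^sup>2 + y\<^sup>2) - (y - x / 2) = x * (x - y)\<^sup>2 / 2 / (x\<^sup>2 + y\<^sup>2)"
      using pos by (metis diff_divide_distrib less_irrefl nonzero_mult_div_cancel_right)
    have "x * (x - y)\<^sup>2 / 2 / (x\<^sup>2 + y\<^sup>2) \<ge> 0"
      using assms(1) by simp
    moreover have "x * (x - y)\<^sup>2 / 2 / (x\<^sup>2 + y\<^sup>2) = 0 \<longleftrightarrow> x = 0 \<or> x = y"
      using pos by auto
    ultimately have "y - x / 2 \<le> y ^ 3 / (x\<^sup>2 + y\<^sup>2)"
      "y ^ 3 / (x\<^sup>2 + y\<^sup>2) = y - x / 2 \<longleftrightarrow> x = 0 \<or> x = y"
      using * by linarith+
    then show ?thesis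
      using True assms(1) by auto
  qed (use assms(1) in auto)
  then show "y - x / 2 \<le> (max y 0) ^ 3 / (x\<^sup>2 + y\<^sup>2)"
    "(max y 0) ^ 3 / (x\<^sup>2 + y\<^sup>2) = y - x / 2 \<longleftrightarrow> y \<ge> 0 \<and> (x > 0 \<longrightarrow> x = y)"
    by auto
qed

text \<open>Dominates the integrand by the integrable function
  \<open>\<bar>D2 \<gamma> t\<bar>\<close>.\<close>

lemma newton_integrand_bound:
  fixes x y :: real
  shows "\<bar>(max y 0) ^ 3 / (x\<^sup>2 + y\<^sup>2)\<bar> \<le> \<bar>y\<bar>"
proof (cases "y > 0")
  case True
  then have "y ^ 3 \<le> y * (x\<^sup>2 + y\<^sup>2)"
    by (simp add: power2_eq_square power3_eq_cube distrib_left)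
  moreover have "x\<^sup>2 + y\<^sup>2 > 0"
    using True by (simp add: sum_power2_gt_zero_iff)
  ultimately have "y ^ 3 / (x\<^sup>2 + y\<^sup>2) \<le> y"
    by (simp add: pos_divide_le_eq)
  moreover have "y ^ 3 / (x\<^sup>2 + y\<^sup>2) \<ge> 0"
    using True by simp
  ultimately show ?thesis
    using True by simp
qed simp

lemma resistance_ge:
  assumes \<gamma>: "abs_continuous_on {0..1} \<gamma>"
    and nz: "AE t\<in>{0<..<1} in lebesgue. norm (vector_derivative \<gamma> (at t)) \<noteq> 0"
    and D1: "AE t\<in>{0<..<1} in lebesgue. D1 \<gamma> t \<ge> 0"
    and ends: "\<gamma> 0 = (0, 0)" "\<gamma> 1 = (a, h)"
  shows "h - a / 2 \<le> resistance \<gamma>"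
    and "resistance \<gamma> = h - a / 2 \<longleftrightarrow>
      (AE t\<in>{0<..<1} in lebesgue. D2 \<gamma> t \<ge> 0) \<and>
      (AE t\<in>{0<..<1} in lebesgue. D1 \<gamma> t > 0 \<longrightarrow> D1 \<gamma> t = D2 \<gamma> t)"
proof -
  let ?I = "{0<..<1::real}"
  define r where "r t = (max (D2 \<gamma> t) 0) ^ 3 / ((D1 \<gamma> t)\<^sup>2 + (D2 \<gamma> t)\<^sup>2)" for t
  \<comment> \<open>The pointwise excess over the linear bound: nonnegative almost everywhere with
    integral \<open>resistance \<gamma> - (h - a / 2)\<close>, so equality holds iff it vanishes
    almost everywhere.\<close>
  define c where "c t = r t - (D2 \<gamma> t - D1 \<gamma> t / 2)" for t
  have d: "AE t\<in>?I in lebesgue. ((\<lambda>t. fst (\<gamma> t)) has_real_derivative D1 \<gamma> t) (at t)"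
    "AE t\<in>?I in lebesgue. ((\<lambda>t. snd (\<gamma> t)) has_real_derivative D2 \<gamma> t) (at t)"
    using abs_continuous_on_curve_derivative[OF \<gamma>] by (auto elim: eventually_mono)
  note i1 = abs_continuous_on_LINT_derivative[OF abs_continuous_on_fst[OF \<gamma>] zero_le_one d(1)]
  note i2 = abs_continuous_on_LINT_derivative[OF abs_continuous_on_snd[OF \<gamma>] zero_le_one d(2)]
  have ir: "set_integrable lebesgue ?I r"
    unfolding set_integrable_def
  proof (rule Bochner_Integration.integrable_bound)
    show "integrable lebesgue (\<lambda>t. indicat_real ?I t *\<^sub>R D2 \<gamma> t)"
      using i2(1) unfolding set_integrable_def .
    have m: "(\<lambda>t. indicat_real ?I t *\<^sub>R D1 \<gamma> t) \<in> borel_measurable lebesgue"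
      "(\<lambda>t. indicat_real ?I t *\<^sub>R D2 \<gamma> t) \<in> borel_measurable lebesgue"
      using i1(1) i2(1) unfolding set_integrable_def by auto
    \<comment> \<open>Measurability is known for the derivatives cut off outside the interval. The
      cutoff can be moved inside because the formula then reads \<open>0 / 0\<close>, which is
      \<open>0\<close>.\<close>
    have "(\<lambda>t. indicat_real ?I t *\<^sub>R r t) =
        (\<lambda>t. (max (indicat_real ?I t *\<^sub>R D2 \<gamma> t) 0) ^ 3 /
          ((indicat_real ?I t *\<^sub>R D1 \<gamma> t)\<^sup>2 + (indicat_real ?I t *\<^sub>R D2 \<gamma> t)\<^sup>2))"
      by (auto simp: r_def indicator_def)
    then show "(\<lambda>t. indicat_real ?I t *\<^sub>R r t) \<in> borel_measurable lebesgue"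
      using m by simp
    show "AE t in lebesgue. norm (indicat_real ?I t *\<^sub>R r t) \<le> norm (indicat_real ?I t *\<^sub>R D2 \<gamma> t)"
      using newton_integrand_bound by (auto simp: r_def indicator_def)
  qed
  have i: "set_integrable lebesgue ?I (\<lambda>t. D2 \<gamma> t - D1 \<gamma> t / 2)"
    "(LINT t:?I|lebesgue. D2 \<gamma> t - D1 \<gamma> t / 2) = h - a / 2"
    using i1 i2 ends by (simp_all add: set_integral_diff)
  have ic: "set_integrable lebesgue ?I c" "(LINT t:?I|lebesgue. c t) = resistance \<gamma> - (h - a / 2)"
    using set_integral_diff[OF ir i(1)] i(2) unfolding c_def by (simp_all add: resistance_def r_def)
  have ae: "AE t in lebesgue. 0 \<le> indicat_real ?I t *\<^sub>R c t \<and>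
      (indicat_real ?I t *\<^sub>R c t = 0 \<longleftrightarrow>
        (t \<in> ?I \<longrightarrow> D2 \<gamma> t \<ge> 0 \<and> (D1 \<gamma> t > 0 \<longrightarrow> D1 \<gamma> t = D2 \<gamma> t)))"
    using nz D1
  proof eventually_elim
    case (elim t)
    show ?case
    proof (cases "t \<in> ?I")
      case True
      then have "D1 \<gamma> t \<ge> 0" "D1 \<gamma> t \<noteq> 0 \<or> D2 \<gamma> t \<noteq> 0"
        using elim by (auto simp: prod_eq_iff)
      from newton_integrand_ge[OF this] True show ?thesis
        by (auto simp: c_def r_def)
    qed auto
  qed
  then have nonneg: "AE t in lebesgue. 0 \<le> indicat_real ?I t *\<^sub>R c t"
    by (auto elim: eventually_mono)
  have "0 \<le> (LINT t:?I|lebesgue. c t)"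
    unfolding set_lebesgue_integral_def using nonneg by (rule integral_nonneg_AE)
  then show "h - a / 2 \<le> resistance \<gamma>"
    using ic(2) by simp
  have "resistance \<gamma> = h - a / 2 \<longleftrightarrow> (AE t in lebesgue. indicat_real ?I t *\<^sub>R c t = 0)"
    using integral_nonneg_eq_0_iff_AE[OF ic(1)[unfolded set_integrable_def] nonneg] ic(2)
    unfolding set_lebesgue_integral_def by auto
  also have "\<dots> \<longleftrightarrow> (AE t in lebesgue. t \<in> ?I \<longrightarrow> D2 \<gamma> t \<ge> 0 \<and> (D1 \<gamma> t > 0 \<longrightarrow> D1 \<gamma> t = D2 \<gamma> t))"
  proof
    assume "AE t in lebesgue. indicat_real ?I t *\<^sub>R c t = 0"
    with ae show "AE t in lebesgue. t \<in> ?I \<longrightarrow> D2 \<gamma> t \<ge> 0 \<and> (D1 \<gamma> t > 0 \<longrightarrow> D1 \<gamma> t = D2 \<gamma> t)"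
      by eventually_elim blast
  next
    assume "AE t in lebesgue. t \<in> ?I \<longrightarrow> D2 \<gamma> t \<ge> 0 \<and> (D1 \<gamma> t > 0 \<longrightarrow> D1 \<gamma> t = D2 \<gamma> t)"
    with ae show "AE t in lebesgue. indicat_real ?I t *\<^sub>R c t = 0"
      by eventually_elim blast
  qed
  also have "\<dots> \<longleftrightarrow> (AE t\<in>?I in lebesgue. D2 \<gamma> t \<ge> 0) \<and>
      (AE t\<in>?I in lebesgue. D1 \<gamma> t > 0 \<longrightarrow> D1 \<gamma> t = D2 \<gamma> t)"
    unfolding imp_conjR AE_conj_iff ..
  finally show "resistance \<gamma> = h - a / 2 \<longleftrightarrow>
      (AE t\<in>?I in lebesgue. D2 \<gamma> t \<ge> 0) \<and>
      (AE t\<in>?I in lebesgue. D1 \<gamma> t > 0 \<longrightarrow> D1 \<gamma> t = D2 \<gamma> t)" .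
qed

text \<open>On the three intervals the integrand has the antiderivatives \<open>0\<close>, half the
  square of the first component, and \<open>a\<close> times the second component. The lemma checks
  the constraint for \<open>opt_curve\<close> and fixes the height of the diagonal in the uniqueness
  proof.\<close>

lemma staircase_area:
  assumes \<gamma>: "abs_continuous_on {0..1} \<gamma>" and t: "0 \<le> t1" "t1 \<le> t2" "t2 \<le> 1"
    and left: "\<And>t. t \<in> {0..t1} \<Longrightarrow> fst (\<gamma> t) = 0"
    and right: "\<And>t. t \<in> {t2..1} \<Longrightarrow> fst (\<gamma> t) = a"
    and diag: "AE t\<in>{t1<..<t2} in lebesgue. D1 \<gamma> t = D2 \<gamma> t"
  shows "(LINT t:{0<..<1}|lebesgue. fst (\<gamma> t) * D2 \<gamma> t)
    = a\<^sup>2 / 2 + a * (snd (\<gamma> 1) - snd (\<gamma> t2))"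
proof -
  define g where "g t = fst (\<gamma> t) * D2 \<gamma> t" for t
  have sub: "{0..t1} \<subseteq> {0..1}" "{t1..t2} \<subseteq> {0..1}" "{t2..1} \<subseteq> {0..1}"
    using t by auto
  note d = abs_continuous_on_curve_derivative[OF \<gamma>]
  note d = AE_Ioo_subset[OF d sub(1)] AE_Ioo_subset[OF d sub(2)]
    AE_Ioo_subset[OF d sub(3)]
  have 1: "abs_continuous_on {0..t1} (\<lambda>_. 0::real)"
    by (rule abs_continuous_on_compose[OF abs_continuous_on_id, of _ _ 0]) simp
  have d1: "AE t\<in>{0<..<t1} in lebesgue. ((\<lambda>_. 0) has_real_derivative g t) (at t)"
    by (rule AE_I2) (simp add: g_def left)
  \<comment> \<open>A bound \<open>B\<close> on the values is a Lipschitz constant of half the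
    square on the range, which keeps the antiderivative absolutely continuous.\<close>
  have "continuous_on {t1..t2} (\<lambda>t. fst (\<gamma> t))"
    by (rule abs_continuous_on_imp_continuous_on[OF abs_continuous_on_subset[OF abs_continuous_on_fst[OF \<gamma>] sub(2)]])
  then have "bounded ((\<lambda>t. fst (\<gamma> t)) ` {t1..t2})"
    by (intro compact_imp_bounded compact_continuous_image) auto
  then obtain B where B: "\<And>t. t \<in> {t1..t2} \<Longrightarrow> \<bar>fst (\<gamma> t)\<bar> \<le> B"
    unfolding bounded_iff by (auto simp del: atLeastAtMost_iff)
  have 2: "abs_continuous_on {t1..t2} (\<lambda>t. (fst (\<gamma> t))\<^sup>2 / 2)"
  proof (rule abs_continuous_on_compose[OF abs_continuous_on_subset[OF abs_continuous_on_fst[OF \<gamma>] sub(2)]])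
    fix x y assume "x \<in> {t1..t2}" "y \<in> {t1..t2}"
    then have "\<bar>(fst (\<gamma> x) + fst (\<gamma> y)) / 2\<bar> \<le> B"
      using B[of x] B[of y] by (simp add: abs_le_iff)
    then have "\<bar>(fst (\<gamma> x) + fst (\<gamma> y)) / 2\<bar> * \<bar>fst (\<gamma> x) - fst (\<gamma> y)\<bar> \<le> B * \<bar>fst (\<gamma> x) - fst (\<gamma> y)\<bar>"
      by (rule mult_right_mono) simp
    then show "dist ((fst (\<gamma> x))\<^sup>2 / 2) ((fst (\<gamma> y))\<^sup>2 / 2) \<le> B * dist (fst (\<gamma> x)) (fst (\<gamma> y))"
      unfolding dist_real_def abs_mult[symmetric] by (simp add: power2_eq_square algebra_simps)
  qed
  have d2: "AE t\<in>{t1<..<t2} in lebesgue. ((\<lambda>t. (fst (\<gamma> t))\<^sup>2 / 2) has_real_derivative g t) (at t)"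
    using d(2) diag
  proof eventually_elim
    case (elim t)
    show ?case
    proof
      assume "t \<in> {t1<..<t2}"
      then have "((\<lambda>t. fst (\<gamma> t)) has_real_derivative D1 \<gamma> t) (at t)" "D1 \<gamma> t = D2 \<gamma> t"
        using elim by auto
      then show "((\<lambda>t. (fst (\<gamma> t))\<^sup>2 / 2) has_real_derivative g t) (at t)"
        unfolding g_def by (auto intro!: derivative_eq_intros)
    qed
  qed
  have 3: "abs_continuous_on {t2..1} (\<lambda>t. a * snd (\<gamma> t))"
    by (rule abs_continuous_on_compose[OF abs_continuous_on_subset[OF abs_continuous_on_snd[OF \<gamma>] sub(3)], of _ "\<bar>a\<bar>"])
      (simp add: dist_real_def abs_mult flip: right_diff_distrib)
  have d3: "AE t\<in>{t2<..<1} in lebesgue. ((\<lambda>t. a * snd (\<gamma> t)) has_real_derivative g t) (at t)"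
    using d(3)
  proof eventually_elim
    case (elim t)
    then show ?case
      using right[of t] unfolding g_def by (auto intro!: derivative_eq_intros)
  qed
  have "g absolutely_integrable_on {0..t1}" "g absolutely_integrable_on {t1..t2}"
    "g absolutely_integrable_on {t2..1}"
    using abs_continuous_on_absolutely_integrable[OF 1 d1] abs_continuous_on_absolutely_integrable[OF 2 d2]
      abs_continuous_on_absolutely_integrable[OF 3 d3] by auto
  then have ai: "g absolutely_integrable_on {0..1}"
    using t by (meson absolutely_integrable_on_combine order_trans)
  have "(g has_integral (0 - 0) + ((fst (\<gamma> t2))\<^sup>2 / 2 - (fst (\<gamma> t1))\<^sup>2 / 2)) {0..t2}"
    using abs_continuous_on_has_integral[OF 1 t(1) d1] abs_continuous_on_has_integral[OF 2 t(2) d2]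
    by (rule has_integral_combine[OF t(1,2)])
  then have "(g has_integral a\<^sup>2 / 2) {0..t2}"
    using left[of t1] right[of t2] t by simp
  then have "(g has_integral a\<^sup>2 / 2 + (a * snd (\<gamma> 1) - a * snd (\<gamma> t2))) {0..1}"
    using abs_continuous_on_has_integral[OF 3 t(3) d3]
    by (rule has_integral_combine[OF order_trans[OF t(1,2)] t(3)])
  then have "integral {0..1} g = a\<^sup>2 / 2 + a * (snd (\<gamma> 1) - snd (\<gamma> t2))"
    by (simp add: integral_unique right_diff_distrib)
  moreover have "set_integrable lebesgue {0<..<1} g"
    by (rule set_integrable_subset[OF ai]) auto
  then have "(LINT t:{0<..<1}|lebesgue. g t) = integral {0..1} g"
    using set_lebesgue_integral_eq_integral(2) integral_open_interval_real[of 0 1 g] by metis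
  ultimately show ?thesis
    unfolding g_def by simp
qed

subsection \<open>The minimizers\<close>

lemma abs_continuous_on_Lipschitz:
  fixes f :: "real \<Rightarrow> 'a::metric_space"
  assumes "\<And>x y. dist (f x) (f y) \<le> B * \<bar>x - y\<bar>"
  shows "abs_continuous_on T f"
  by (rule abs_continuous_on_compose[OF abs_continuous_on_id, of _ _ B])
    (use assms in \<open>auto simp: dist_real_def\<close>)

lemma AE_in_finite_exception:
  assumes "finite F" "\<And>t. t \<in> S \<Longrightarrow> t \<notin> F \<Longrightarrow> P t"
  shows "AE t\<in>S in lebesgue. P (t::real)"
  using assms by (intro AE_I'[of F]) (auto simp: negligible_finite simp flip: negligible_iff_null_sets)

text \<open>\<open>q\<close> is the height of the last vertical segment, and \<open>p\<close> solves
  \<open>a\<^sup>2 / 2 + a * q = a * h - L\<close>. The two bounds on \<open>2 * L\<close> in the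
  theorem say exactly that \<open>p\<close> and \<open>q\<close> are positive.\<close>

context
  fixes a h L p q :: real
  assumes a: "0 < a" and p: "0 < p" "p = L / a - a / 2" and q: "0 < q" "q = h - p - a"
begin

text \<open>\<open>+++\<close> associates to the right, so the segments occupy
  \<open>[0, 1/2]\<close>, \<open>[1/2, 3/4]\<close> and \<open>[3/4, 1]\<close>. The outer formulas
  continue beyond \<open>[0, 1]\<close>.\<close>

lemma opt_curve_simps:
  "s \<le> 1/2 \<Longrightarrow> opt_curve a h L s = (0, 2 * p * s)"
  "1/2 \<le> s \<Longrightarrow> s \<le> 3/4 \<Longrightarrow> opt_curve a h L s = (a * (4 * s - 2), p + a * (4 * s - 2))"
  "3/4 \<le> s \<Longrightarrow> opt_curve a h L s = (a, p + a + q * (4 * s - 3))"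
proof -
  show "s \<le> 1/2 \<Longrightarrow> opt_curve a h L s = (0, 2 * p * s)"
    unfolding opt_curve_def p(2)[symmetric] Let_def joinpaths_def linepath_def by simp
  show "3/4 \<le> s \<Longrightarrow> opt_curve a h L s = (a, p + a + q * (4 * s - 3))"
    unfolding opt_curve_def p(2)[symmetric] Let_def joinpaths_def linepath_def q(2)
    by (cases "s = 3/4") (auto simp: algebra_simps)
  show "1/2 \<le> s \<Longrightarrow> s \<le> 3/4 \<Longrightarrow> opt_curve a h L s = (a * (4 * s - 2), p + a * (4 * s - 2))"
    unfolding opt_curve_def p(2)[symmetric] Let_def joinpaths_def linepath_def
    by (cases "s = 1/2") (auto simp: algebra_simps)
qed

lemma opt_curve_ends: "opt_curve a h L 0 = (0, 0)" "opt_curve a h L 1 = (a, h)"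
  using opt_curve_simps(1)[of 0] opt_curve_simps(3)[of 1] q(2) by auto

lemma opt_curve_derivative:
  "t < 1/2 \<Longrightarrow> vector_derivative (opt_curve a h L) (at t) = (0, 2 * p)"
  "1/2 < t \<Longrightarrow> t < 3/4 \<Longrightarrow> vector_derivative (opt_curve a h L) (at t) = (4 * a, 4 * a)"
  "3/4 < t \<Longrightarrow> vector_derivative (opt_curve a h L) (at t) = (0, 4 * q)"
proof -
  have eq: "vector_derivative (opt_curve a h L) (at t) = v"
    if "\<And>s. s \<in> S \<Longrightarrow> opt_curve a h L s = w + s *\<^sub>R v" "open S" "t \<in> S" for S v w
  proof (rule vector_derivative_at)
    have "((\<lambda>s. w + s *\<^sub>R v) has_vector_derivative v) (at t)"
      by (auto intro!: derivative_eq_intros)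
    then show "(opt_curve a h L has_vector_derivative v) (at t)"
      by (rule has_vector_derivative_transform_within_open[OF _ that(2,3)]) (simp add: that(1))
  qed
  show "t < 1/2 \<Longrightarrow> vector_derivative (opt_curve a h L) (at t) = (0, 2 * p)"
    by (rule eq[of "{..<1/2}" "(0, 0)"]) (auto simp: opt_curve_simps)
  show "1/2 < t \<Longrightarrow> t < 3/4 \<Longrightarrow> vector_derivative (opt_curve a h L) (at t) = (4 * a, 4 * a)"
    by (rule eq[of "{1/2<..<3/4}" "(- 2 * a, p - 2 * a)"]) (auto simp: opt_curve_simps algebra_simps)
  show "3/4 < t \<Longrightarrow> vector_derivative (opt_curve a h L) (at t) = (0, 4 * q)"
    by (rule eq[of "{3/4<..}" "(a, p + a - 3 * q)"]) (auto simp: opt_curve_simps algebra_simps)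
qed

text \<open>Three nondecreasing ramps with positive coefficients: Lipschitz and monotonicity
  estimates need no case distinction on which segments contain the two parameters.\<close>

lemma opt_curve_ramps:
  "opt_curve a h L s = (a * max 0 (min 1 (4 * s - 2)),
    p * min 1 (2 * s) + a * max 0 (min 1 (4 * s - 2)) + q * max 0 (4 * s - 3))"
proof -
  consider "s \<le> 1/2" | "1/2 \<le> s" "s \<le> 3/4" | "3/4 \<le> s"
    by linarith
  then show ?thesis
  proof cases
    case 1
    then have "min 1 (2 * s) = 2 * s" "max 0 (min 1 (4 * s - 2)) = 0" "max 0 (4 * s - 3) = 0"
      by auto
    then show ?thesis
      using opt_curve_simps(1)[OF 1] by (simp only:) simp
  next
    case 2
    then have "min 1 (2 * s) = 1" "max 0 (min 1 (4 * s - 2)) = 4 * s - 2" "max 0 (4 * s - 3) = 0"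
      by auto
    then show ?thesis
      using opt_curve_simps(2)[OF 2] by (simp only:) simp
  next
    case 3
    then have "min 1 (2 * s) = 1" "max 0 (min 1 (4 * s - 2)) = 1" "max 0 (4 * s - 3) = 4 * s - 3"
      by auto
    then show ?thesis
      using opt_curve_simps(3)[OF 3] by (simp only:) simp
  qed
qed

lemma abs_continuous_on_opt_curve: "abs_continuous_on T (opt_curve a h L)"
\<comment> \<open>The ramps have slopes at most \<open>2\<close>, \<open>4\<close>,
  \<open>4\<close>; the one with coefficient \<open>a\<close> occurs in both coordinates, hence
  \<open>8 * a\<close>.\<close>
proof (rule abs_continuous_on_Lipschitz[of _ "2 * p + 8 * a + 4 * q"])
  fix s t :: real
  define w1 where "w1 s = min 1 (2 * s)" for s :: real
  define w2 where "w2 s = max 0 (min 1 (4 * s - 2))" for s :: real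
  define w3 where "w3 s = max 0 (4 * s - 3)" for s :: real
  have "\<bar>p * (w1 s - w1 t)\<bar> \<le> p * (2 * \<bar>s - t\<bar>)" "\<bar>a * (w2 s - w2 t)\<bar> \<le> a * (4 * \<bar>s - t\<bar>)"
    "\<bar>q * (w3 s - w3 t)\<bar> \<le> q * (4 * \<bar>s - t\<bar>)"
    unfolding abs_mult w1_def w2_def w3_def using a p(1) q(1)
    by (auto intro!: mult_mono simp: abs_real_def max_def min_def)
  moreover have "dist (opt_curve a h L s) (opt_curve a h L t) \<le> \<bar>a * (w2 s - w2 t)\<bar>
      + \<bar>p * (w1 s - w1 t) + a * (w2 s - w2 t) + q * (w3 s - w3 t)\<bar>"
    unfolding opt_curve_ramps w1_def[symmetric] w2_def[symmetric] w3_def[symmetric] dist_Pair_Pair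
    by (rule order_trans[OF sqrt_sum_squares_le_sum_abs]) (simp add: dist_real_def algebra_simps)
  moreover have "(2 * p + 8 * a + 4 * q) * \<bar>s - t\<bar>
      = p * (2 * \<bar>s - t\<bar>) + 2 * (a * (4 * \<bar>s - t\<bar>)) + q * (4 * \<bar>s - t\<bar>)"
    by (simp add: algebra_simps)
  ultimately show "dist (opt_curve a h L s) (opt_curve a h L t) \<le> (2 * p + 8 * a + 4 * q) * \<bar>s - t\<bar>"
    by linarith
qed

text \<open>Between two parameters no ramp decreases and at least one strictly increases. This
  yields injectivity, and it makes the coordinate sum invertible for the reparametrization.\<close>

lemma opt_curve_strict_mono: "strict_mono (\<lambda>s. fst (opt_curve a h L s) + snd (opt_curve a h L s))"
proof (rule strict_monoI)
  fix s t :: real assume "s < t"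
  define w1 where "w1 s = min 1 (2 * s)" for s :: real
  define w2 where "w2 s = max 0 (min 1 (4 * s - 2))" for s :: real
  define w3 where "w3 s = max 0 (4 * s - 3)" for s :: real
  have le: "w1 s \<le> w1 t" "w2 s \<le> w2 t" "w3 s \<le> w3 t"
    and "w1 s < w1 t \<or> w2 s < w2 t \<or> w3 s < w3 t"
    using \<open>s < t\<close> by (auto simp: w1_def w2_def w3_def)
  then have "0 < p * (w1 t - w1 s) \<or> 0 < a * (w2 t - w2 s) \<or> 0 < q * (w3 t - w3 s)"
    using a p q by auto
  moreover have "0 \<le> p * (w1 t - w1 s)" "0 \<le> a * (w2 t - w2 s)" "0 \<le> q * (w3 t - w3 s)"
    using a p q le by auto
  ultimately show "fst (opt_curve a h L s) + snd (opt_curve a h L s)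
      < fst (opt_curve a h L t) + snd (opt_curve a h L t)"
    unfolding opt_curve_ramps w1_def[symmetric] w2_def[symmetric] w3_def[symmetric]
    by (simp only: fst_conv snd_conv right_diff_distrib) linarith
qed

lemma opt_curve_admissible: "opt_curve a h L \<in> admissible a h L"
proof -
  have cont: "continuous_on {0..1} (opt_curve a h L)"
    by (rule abs_continuous_on_imp_continuous_on[OF abs_continuous_on_opt_curve])
  have "inj (opt_curve a h L)"
    using strict_mono_imp_inj_on[OF opt_curve_strict_mono] unfolding inj_on_def by metis
  then have "arc (opt_curve a h L)"
    using cont inj_on_subset by (auto simp: arc_def path_def)
  moreover have "opt_curve a h L ` {0..1} \<subseteq> {0..a} \<times> {0..h}"
  proof (clarsimp simp only: image_subset_iff)
    fix s :: real assume "s \<in> {0..1}"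
    then have *: "s \<ge> 0" "s \<le> 1"
      by auto
    have "a * max 0 (min 1 (4 * s - 2)) \<le> a" "p * min 1 (2 * s) \<le> p" "q * max 0 (4 * s - 3) \<le> q"
      using a p q * by auto
    moreover have "0 \<le> a * max 0 (min 1 (4 * s - 2))" "0 \<le> p * min 1 (2 * s)" "0 \<le> q * max 0 (4 * s - 3)"
      using a p q * by auto
    ultimately show "opt_curve a h L s \<in> {0..a} \<times> {0..h}"
      unfolding opt_curve_ramps using q(2) by simp
  qed
  moreover have "AE t\<in>{0<..<1} in lebesgue. norm (vector_derivative (opt_curve a h L) (at t)) \<noteq> 0"
  proof (rule AE_in_finite_exception[of "{1/2, 3/4}"])
    fix t :: real assume "t \<notin> {1/2, 3/4}"
    then consider "t < 1/2" | "1/2 < t" "t < 3/4" | "3/4 < t"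
      by fastforce
    then show "norm (vector_derivative (opt_curve a h L) (at t)) \<noteq> 0"
      using a p(1) q(1) by cases (simp_all add: opt_curve_derivative zero_prod_def)
  qed simp
  moreover have "AE t\<in>{0<..<1} in lebesgue. D1 (opt_curve a h L) t \<ge> 0"
  proof (rule AE_in_finite_exception[of "{1/2, 3/4}"])
    fix t :: real assume "t \<notin> {1/2, 3/4}"
    then consider "t < 1/2" | "1/2 < t" "t < 3/4" | "3/4 < t"
      by fastforce
    then show "D1 (opt_curve a h L) t \<ge> 0"
      using a by cases (simp_all add: opt_curve_derivative)
  qed simp
  moreover have "(LINT t:{0<..<1}|lebesgue. fst (opt_curve a h L t) * D2 (opt_curve a h L) t) = a * h - L"
  proof -
    have "(LINT t:{0<..<1}|lebesgue. fst (opt_curve a h L t) * D2 (opt_curve a h L) t)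
        = a\<^sup>2 / 2 + a * (snd (opt_curve a h L 1) - snd (opt_curve a h L (3/4)))"
      by (rule staircase_area[OF abs_continuous_on_opt_curve, of "1/2"])
        (auto simp: opt_curve_simps opt_curve_derivative)
    also have "\<dots> = a * h - L"
      using a by (simp add: opt_curve_simps p(2) q(2) field_simps power2_eq_square)
    finally show ?thesis .
  qed
  ultimately show ?thesis
    unfolding admissible_def using abs_continuous_on_opt_curve opt_curve_ends arc_imp_simple_path by blast
qed

lemma opt_curve_minimality_condition:
  "AE t\<in>{0<..<1} in lebesgue. D2 (opt_curve a h L) t \<ge> 0"
  "AE t\<in>{0<..<1} in lebesgue. D1 (opt_curve a h L) t > 0 \<longrightarrow> D1 (opt_curve a h L) t = D2 (opt_curve a h L) t"
  "AE t\<in>{0<..<1} in lebesgue. D1 (opt_curve a h L) t > 0 \<longleftrightarrow> t \<in> {1/2<..<3/4}"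
proof -
  have "D2 (opt_curve a h L) t \<ge> 0 \<and>
      (D1 (opt_curve a h L) t > 0 \<longrightarrow> D1 (opt_curve a h L) t = D2 (opt_curve a h L) t) \<and>
      (D1 (opt_curve a h L) t > 0 \<longleftrightarrow> t \<in> {1/2<..<3/4})" if "t \<notin> {1/2, 3/4}" for t :: real
  proof -
    consider "t < 1/2" | "1/2 < t" "t < 3/4" | "3/4 < t"
      using \<open>t \<notin> {1/2, 3/4}\<close> by fastforce
    then show ?thesis
      using a p(1) q(1) by cases (simp_all add: opt_curve_derivative)
  qed
  then show "AE t\<in>{0<..<1} in lebesgue. D2 (opt_curve a h L) t \<ge> 0"
    "AE t\<in>{0<..<1} in lebesgue. D1 (opt_curve a h L) t > 0 \<longrightarrow> D1 (opt_curve a h L) t = D2 (opt_curve a h L) t"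
    "AE t\<in>{0<..<1} in lebesgue. D1 (opt_curve a h L) t > 0 \<longleftrightarrow> t \<in> {1/2<..<3/4}"
    by (intro AE_in_finite_exception[of "{1/2, 3/4}"]; simp)+
qed

section \<open>Uniqueness up to reparametrization\<close>

text \<open>A point of the set in assumption \<open>range\<close> is determined by the sum of its coordinates, so this
  sum serves as a common parameter.\<close>

lemma reparametrization_opt_curve:
  assumes cont: "continuous_on {0..1} \<gamma>" and ends: "\<gamma> 0 = (0, 0)" "\<gamma> 1 = (a, h)"
    and mono: "mono_on {0..1} (\<lambda>t. fst (\<gamma> t))" "mono_on {0..1} (\<lambda>t. snd (\<gamma> t))"
    and range: "\<And>t. t \<in> {0..1} \<Longrightarrow> (fst (\<gamma> t) = 0 \<and> snd (\<gamma> t) \<le> p) \<or>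
      (0 \<le> fst (\<gamma> t) \<and> fst (\<gamma> t) \<le> a \<and> snd (\<gamma> t) = fst (\<gamma> t) + p) \<or>
      (fst (\<gamma> t) = a \<and> p + a \<le> snd (\<gamma> t))"
  shows "reparametrization \<gamma> (opt_curve a h L)"
proof -
  let ?o = "opt_curve a h L"
  define S where "S s = fst (?o s) + snd (?o s)" for s
  define \<sigma> where "\<sigma> t = fst (\<gamma> t) + snd (\<gamma> t)" for t
  have S_mono: "strict_mono S"
    unfolding S_def by (rule opt_curve_strict_mono)
  have contS: "continuous_on {0..1} S"
    unfolding S_def
    by (intro continuous_intros abs_continuous_on_imp_continuous_on[OF abs_continuous_on_opt_curve])
  have cont\<sigma>: "continuous_on {0..1} \<sigma>"
    unfolding \<sigma>_def by (intro continuous_intros cont)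
  have S_ends: "S 0 = 0" "S 1 = a + h"
    unfolding S_def by (simp_all add: opt_curve_ends)
  have \<sigma>_ends: "\<sigma> 0 = 0" "\<sigma> 1 = a + h"
    unfolding \<sigma>_def by (simp_all add: ends)
  have \<sigma>_mono: "\<sigma> t \<le> \<sigma> t'" if "t \<in> {0..1}" "t' \<in> {0..1}" "t \<le> t'" for t t'
    unfolding \<sigma>_def by (intro add_mono mono_onD[OF mono(1)] mono_onD[OF mono(2)] that)
  \<comment> \<open>The reparametrization is the inverse of \<open>S\<close> after
    \<open>\<sigma>\<close>: the intermediate value theorem gives existence, strict monotonicity of
    \<open>S\<close> uniqueness.\<close>
  have "\<exists>s\<in>{0..1}. S s = \<sigma> t" if "t \<in> {0..1}" for t
  proof -
    have "S 0 \<le> \<sigma> t" "\<sigma> t \<le> S 1"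
      using \<sigma>_mono[of 0 t] \<sigma>_mono[of t 1] that S_ends \<sigma>_ends by auto
    then show ?thesis
      using IVT'[of S 0 "\<sigma> t" 1] contS by auto
  qed
  then obtain \<phi> where \<phi>: "\<And>t. t \<in> {0..1} \<Longrightarrow> \<phi> t \<in> {0..1}" "\<And>t. t \<in> {0..1} \<Longrightarrow> S (\<phi> t) = \<sigma> t"
    by metis
  have "mono_on {0..1} \<phi>"
    using \<sigma>_mono \<phi>(2) strict_mono_less_eq[OF S_mono] by (metis mono_onI)
  moreover have "\<phi> ` {0..1} = {0..1}"
  proof
    show "\<phi> ` {0..1} \<subseteq> {0..1}"
      using \<phi>(1) by blast
    show "{0..1} \<subseteq> \<phi> ` {0..1}"
    proof
      fix s :: real assume s: "s \<in> {0..1}"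
      then have "\<sigma> 0 \<le> S s" "S s \<le> \<sigma> 1"
        using strict_mono_less_eq[OF S_mono, of 0 s] strict_mono_less_eq[OF S_mono, of s 1]
          S_ends \<sigma>_ends by auto
      then obtain t where "t \<in> {0..1}" "\<sigma> t = S s"
        using IVT'[of \<sigma> 0 "S s" 1] cont\<sigma> by auto
      then have "\<phi> t = s"
        using \<phi>(2) strict_mono_eq[OF S_mono] by metis
      with \<open>t \<in> {0..1}\<close> show "s \<in> \<phi> ` {0..1}"
        by blast
    qed
  qed
  moreover have "\<gamma> t = ?o (\<phi> t)" if "t \<in> {0..1}" for t
  proof -
    \<comment> \<open>The three pieces belong to sums at most \<open>p\<close>, between
      \<open>p\<close> and \<open>p + 2 * a\<close>, and at least \<open>p + 2 * a\<close>.\<close>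
    have "fst (\<gamma> t) + snd (\<gamma> t) = fst (?o (\<phi> t)) + snd (?o (\<phi> t))"
      using \<phi>(2)[OF that] unfolding S_def \<sigma>_def by simp
    moreover have "(fst (?o s) = 0 \<and> snd (?o s) \<le> p) \<or>
      (0 \<le> fst (?o s) \<and> fst (?o s) \<le> a \<and> snd (?o s) = fst (?o s) + p) \<or>
      (fst (?o s) = a \<and> p + a \<le> snd (?o s))" for s
    proof -
      consider "s \<le> 1/2" | "1/2 \<le> s" "s \<le> 3/4" | "3/4 \<le> s"
        by linarith
      then show ?thesis
        using a p(1) q(1) by cases (auto simp: opt_curve_simps)
    qed
    note this[of "\<phi> t"]
    ultimately show ?thesis
      using range[OF that] a by (auto simp: prod_eq_iff)
  qed
  ultimately show ?thesis
    unfolding reparametrization_def by blast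
qed

text \<open>Outside \<open>(t1, t2)\<close> the derivative \<open>D1\<close> is nonnegative and not
  positive, so the first component is constant there; inside, \<open>D1 = D2\<close> makes the
  difference of the components constant. Monotonicity of both components confines each piece to the
  matching piece of \<open>opt_curve\<close>.\<close>

lemma interval_support_reparametrization:
  assumes \<gamma>: "\<gamma> \<in> admissible a h L"
    and D2: "AE t\<in>{0<..<1} in lebesgue. D2 \<gamma> t \<ge> 0"
    and diag: "AE t\<in>{0<..<1} in lebesgue. D1 \<gamma> t > 0 \<longrightarrow> D1 \<gamma> t = D2 \<gamma> t"
    and support: "interval_support \<gamma>"
  shows "reparametrization \<gamma> (opt_curve a h L)"
proof -
  obtain t1 t2 where t: "0 < t1" "t1 < t2" "t2 < 1"
    and supp: "AE t\<in>{0<..<1} in lebesgue. D1 \<gamma> t > 0 \<longleftrightarrow> t \<in> {t1<..<t2}"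
    using support unfolding interval_support_def by blast
  have ac: "abs_continuous_on {0..1} \<gamma>" and ends: "\<gamma> 0 = (0, 0)" "\<gamma> 1 = (a, h)"
    and D1: "AE t\<in>{0<..<1} in lebesgue. D1 \<gamma> t \<ge> 0"
    and area: "(LINT t:{0<..<1}|lebesgue. fst (\<gamma> t) * D2 \<gamma> t) = a * h - L"
    using \<gamma> unfolding admissible_def by auto
  let ?x = "\<lambda>t. fst (\<gamma> t)" and ?y = "\<lambda>t. snd (\<gamma> t)"
  note acx = abs_continuous_on_fst[OF ac] and acy = abs_continuous_on_snd[OF ac]
  have all: "AE t\<in>{0<..<1} in lebesgue. (?x has_real_derivative D1 \<gamma> t) (at t) \<and>
      (?y has_real_derivative D2 \<gamma> t) (at t) \<and> D1 \<gamma> t \<ge> 0 \<and> D2 \<gamma> t \<ge> 0 \<and>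
      (D1 \<gamma> t > 0 \<longleftrightarrow> t \<in> {t1<..<t2}) \<and> (D1 \<gamma> t > 0 \<longrightarrow> D1 \<gamma> t = D2 \<gamma> t)"
    using abs_continuous_on_curve_derivative[OF ac] D1 D2 diag supp by eventually_elim blast
  have mono: "mono_on {0..1} ?x" "mono_on {0..1} ?y"
    by (rule abs_continuous_on_mono[OF acx, of "D1 \<gamma>"], use all in \<open>auto elim: eventually_mono\<close>)
      (rule abs_continuous_on_mono[OF acy, of "D2 \<gamma>"], use all in \<open>auto elim: eventually_mono\<close>)
  have sub: "{0..t1} \<subseteq> {0..1}" "{t1..t2} \<subseteq> {0..1}" "{t2..1} \<subseteq> {0..1}"
    using t by auto
  have left: "?x s = 0" if "s \<in> {0..t1}" for s
  proof -
    have "?x s = ?x 0"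
    proof (rule abs_continuous_on_const[OF abs_continuous_on_subset[OF acx sub(1)]])
      show "AE t\<in>{0<..<t1} in lebesgue. (?x has_real_derivative 0) (at t)"
        using AE_Ioo_subset[OF all sub(1)]
        by (rule eventually_mono) (auto simp: order.order_iff_strict)
    qed (use that t in auto)
    then show ?thesis
      by (simp add: ends)
  qed
  have right: "?x s = a" if "s \<in> {t2..1}" for s
  proof -
    have "?x s = ?x 1"
    proof (rule abs_continuous_on_const[OF abs_continuous_on_subset[OF acx sub(3)]])
      show "AE t\<in>{t2<..<1} in lebesgue. (?x has_real_derivative 0) (at t)"
        using AE_Ioo_subset[OF all sub(3)]
        by (rule eventually_mono) (auto simp: order.order_iff_strict)
    qed (use that t in auto)
    then show ?thesis
      by (simp add: ends)
  qed
  have acd: "abs_continuous_on {0..1} (\<lambda>t. ?y t - ?x t)"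
  proof (rule abs_continuous_on_compose[OF ac])
    show "dist (?y s - ?x s) (?y t - ?x t) \<le> 2 * dist (\<gamma> s) (\<gamma> t)" for s t
      using dist_fst_le[of "\<gamma> s" "\<gamma> t"] dist_snd_le[of "\<gamma> s" "\<gamma> t"] unfolding dist_real_def by linarith
  qed
  have middle: "?y s = ?x s + ?y t1" if "s \<in> {t1..t2}" for s
  proof -
    have "?y s - ?x s = ?y t1 - ?x t1"
    proof (rule abs_continuous_on_const[OF abs_continuous_on_subset[OF acd sub(2)]])
      show "AE t\<in>{t1<..<t2} in lebesgue. ((\<lambda>t. ?y t - ?x t) has_real_derivative 0) (at t)"
        using AE_Ioo_subset[OF all sub(2)]
      proof (rule eventually_mono, intro impI)
        fix t assume *: "t \<in> {t1<..<t2} \<longrightarrow> (?x has_real_derivative D1 \<gamma> t) (at t) \<and>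
          (?y has_real_derivative D2 \<gamma> t) (at t) \<and> D1 \<gamma> t \<ge> 0 \<and> D2 \<gamma> t \<ge> 0 \<and>
          (D1 \<gamma> t > 0 \<longleftrightarrow> t \<in> {t1<..<t2}) \<and> (D1 \<gamma> t > 0 \<longrightarrow> D1 \<gamma> t = D2 \<gamma> t)"
          and "t \<in> {t1<..<t2}"
        then show "((\<lambda>t. ?y t - ?x t) has_real_derivative 0) (at t)"
          by (auto intro!: derivative_eq_intros)
      qed
    qed (use that t in auto)
    then show ?thesis
      using left[of t1] t by simp
  qed
  have "AE t\<in>{t1<..<t2} in lebesgue. D1 \<gamma> t = D2 \<gamma> t"
    using AE_Ioo_subset[OF all sub(2)] by (auto elim: eventually_mono)
  then have "a * h - L = a\<^sup>2 / 2 + a * (snd (\<gamma> 1) - snd (\<gamma> t2))"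
    using staircase_area[OF ac, of t1 t2 a] t left right area by simp
  moreover have "?y t2 = a + ?y t1"
    using middle[of t2] right[of t2] t by simp
  \<comment> \<open>The area identity has become
    \<open>a * h - L = a\<^sup>2 / 2 + a * (h - a - y)\<close> for the height \<open>y\<close> at
    \<open>t1\<close>, a linear equation with solution \<open>p\<close>.\<close>
  ultimately have yt1: "?y t1 = p"
    using a unfolding p(2) by (simp add: ends field_simps power2_eq_square)
  show ?thesis
  proof (rule reparametrization_opt_curve[OF _ ends mono])
    show "continuous_on {0..1} \<gamma>"
      using ac by (rule abs_continuous_on_imp_continuous_on)
    fix s :: real assume s: "s \<in> {0..1}"
    then consider "s \<in> {0..t1}" | "s \<in> {t1..t2}" | "s \<in> {t2..1}"
      by fastforce
    then show "(?x s = 0 \<and> ?y s \<le> p) \<or> (0 \<le> ?x s \<and> ?x s \<le> a \<and> ?y s = ?x s + p) \<or> (?x s = a \<and> p + a \<le> ?y s)"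
    proof cases
      case 1
      then have "?y s \<le> ?y t1"
        using t s by (intro mono_onD[OF mono(2)]) auto
      then show ?thesis
        using left[OF 1] yt1 by simp
    next
      case 2
      have "?x 0 \<le> ?x s" "?x s \<le> ?x 1"
        using s by (auto intro: mono_onD[OF mono(1)])
      then show ?thesis
        using middle[OF 2] yt1 by (simp add: ends)
    next
      case 3
      then have "?y t2 \<le> ?y s"
        using t s by (intro mono_onD[OF mono(2)]) auto
      then show ?thesis
        using right[OF 3] \<open>?y t2 = a + ?y t1\<close> yt1 by simp
    qed
  qed
qed

end

theorem theorem2p4:
  fixes a h L :: real
  assumes "0 < a" and "a < h"
    and "2 * L \<in> {a\<^sup>2 <..< 2 * a * h - a\<^sup>2}"
  shows "(\<forall>\<gamma>\<in>admissible a h L.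
            solution a h L \<gamma> \<longleftrightarrow>
              (AE t\<in>{0<..<1} in lebesgue. D2 \<gamma> t \<ge> 0) \<and>
              (AE t\<in>{0<..<1} in lebesgue. D1 \<gamma> t > 0 \<longrightarrow> D1 \<gamma> t = D2 \<gamma> t))
       \<and> solution a h L (opt_curve a h L)
       \<and> interval_support (opt_curve a h L)
       \<and> (\<forall>\<gamma>. solution a h L \<gamma> \<and> interval_support \<gamma> \<longrightarrow>
              reparametrization \<gamma> (opt_curve a h L))"
proof -
  define p where "p = L / a - a / 2"
  define q where "q = h - p - a"
  have p: "0 < p"
    using assms unfolding p_def by (simp add: field_simps power2_eq_square)
  have q: "0 < q"
    using assms unfolding q_def p_def by (simp add: field_simps power2_eq_square)
  note ctx = \<open>0 < a\<close> p p_def q q_def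
  let ?o = "opt_curve a h L"
  have ge: "h - a / 2 \<le> resistance \<gamma>" and eq: "resistance \<gamma> = h - a / 2 \<longleftrightarrow>
      (AE t\<in>{0<..<1} in lebesgue. D2 \<gamma> t \<ge> 0) \<and>
      (AE t\<in>{0<..<1} in lebesgue. D1 \<gamma> t > 0 \<longrightarrow> D1 \<gamma> t = D2 \<gamma> t)"
    if "\<gamma> \<in> admissible a h L" for \<gamma>
    using resistance_ge[of \<gamma> a h] that unfolding admissible_def by auto
  have oadm: "?o \<in> admissible a h L"
    by (rule opt_curve_admissible[OF ctx])
  have omin: "resistance ?o = h - a / 2"
    using eq[OF oadm] opt_curve_minimality_condition(1,2)[OF ctx] by blast
  \<comment> \<open>\<open>?o\<close> attains the lower bound, so the minimum is
    \<open>h - a / 2\<close> and solutions are the admissible curves with this resistance.\<close>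
  have sol: "solution a h L \<gamma> \<longleftrightarrow> resistance \<gamma> = h - a / 2" if "\<gamma> \<in> admissible a h L" for \<gamma>
    using ge that oadm omin unfolding solution_def by (metis order_antisym)
  have "interval_support ?o"
    unfolding interval_support_def
    using opt_curve_minimality_condition(3)[OF ctx] by (intro exI[of _ "1/2"] exI[of _ "3/4"]) simp
  moreover have "reparametrization \<gamma> ?o" if "solution a h L \<gamma>" "interval_support \<gamma>" for \<gamma>
  proof -
    have "\<gamma> \<in> admissible a h L"
      using that(1) unfolding solution_def by blast
    then show ?thesis
      using interval_support_reparametrization[OF ctx] sol eq that by blast
  qed
  ultimately show ?thesis
    using sol eq oadm omin by blast
qed

end
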